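(* Let $n\ge 2$, and let $(M_{\rm ext}, g_{\rm ext})$ be a continuous extension of a smooth spacetime $(M,g)$ of dimension $n+1$ such that $M = I^+(\mathcal{O}, M_{\rm ext})$ for some point $\mathcal{O} \in \partial^- M$. Assume (a), (b), (c), and at least one of (d), (d$'$): (a) $(M,g)$ solves the Einstein equations with a perfect fluid $(u,\rho,p)$, i.e. $\mathrm{Ric} - \frac{1}{2}Rg = 8\pi\big[(\rho+p)\,u_*\otimes u_* + p\,g\big]$ on $M$. (b) All the integral curves of $u$ have past endpoint $\mathcal{O}$ within $M_{\rm ext}$. Moreover, each of these extended curves is a future directed timelike curve in $M_{\rm ext}$ on any compact domain; that is, if $\gamma\colon[0,b]\to M\cup\{\mathcal{O}\}$ is an integral curve of $u$ on $(0,b]$ with past endpoint $\gamma(0)=\mathcal{O}$, then $\gamma$ is a future directed timelike curve within $M_{\rm ext}$. (c) The Ricci tensor $\mathrm{Ric}$ of $(M,g)$, the function $\rho$, and the function $p$ all extend continuously to $M\cup\{\mathcal{O}\}$. (d) $(M_{\rm ext}, g_{\rm ext})$ is strongly causal at $\mathcal{O}$. (d$'$) For any neighborhood $U$ of $\mathcal{O}$ in $M_{\rm ext}$, there is a neighborhood $V\subset U$ of $\mathcal{O}$ such that $\partial^-M\cap V\subset J^+(\mathcal{O},V)$. Then the scalar curvature $R$ of $(M,g)$ extends continuously to $M\cup\{\mathcal{O}\}$, and its continuous extension $\widetilde{R}$ satisfies $$\widetilde{R}(\mathcal{O}) = 16\pi\,\frac{n+1}{n-1}\,\widetilde{\rho}(\mathcal{O}),$$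 where $\widetilde\rho$ is the continuous extension of $\rho$. In particular, when the spacetime dimension is $n+1=4$, $\widetilde R(\mathcal{O})=32\pi\,\widetilde\rho(\mathcal{O})$.
   Context: Spacetimes. A spacetime $(M,g)$ is a smooth (connected, Hausdorff, second countable) manifold $M$ of dimension $n+1$ with a time-oriented Lorentzian metric $g$ of signature $(-,+,\dots,+)$. It is smooth (resp. continuous) if the components $g_{\mu\nu}=g(\partial_\mu,\partial_\nu)$ are smooth (resp. continuous) in any coordinates $(x^0,\dots,x^n)$; the manifold is always smooth. Curves. In a continuous spacetime, a future directed causal curve is a locally Lipschitz curve $\gamma$ (with respect to some complete smooth Riemannian metric) such that $\gamma'$ is future directed causal (in particular nonzero) almost everywhere. A future directed timelike curve $\gamma\colon[a,b]\to M$ is a Lipschitz curve that is future directed timelike almost everywhere and satisfies $g(\gamma',\gamma')<-\varepsilon$ almost everywhere for some $\varepsilon>0$. $I^+(q,M)$ is the set of endpoints of future directed timelike curves in $M$ starting at $q$. For an open set $V$ and $q\in V$, $J^+(q,V)$ is the set consisting of $q$ and all endpoints of future directed causal curves starting at $q$ and contained in $V$. Extensions. A continuous spacetime $(M_{\rm ext},g_{\rm ext})$ is a continuous extension of a smooth spacetime $(M,g)$ if $M$ and $M_{\rm ext}$ have the same dimension and there is an isometric embedding $(M,g)\hookrightarrow(M_{\rm ext},g_{\rm ext})$ preserving time orientations whose image is a proper subset; $M$ is identified with its image. $\partial M=\overline{M}\setminus M$ is the topological boundary of $M$ in $M_{\rm ext}$. The past boundary $\partial^-M$ is the set of $q\in\partial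 M$ for which there is a future directed timelike curve $\gamma\colon[a,b]\to M_{\rm ext}$ with $\gamma(a)=q$ and $\gamma((a,b])\subset M$. Perfect fluid. $u$ is a smooth future directed timelike vector field on $M$ with $g(u,u)=-1$, $\rho$ and $p$ are smooth real functions on $M$, $u_*=g(u,\cdot)$ is the one-form metrically equivalent to $u$, and $R$ is the scalar curvature of $g$. Past endpoint. An integral curve of $u$ (maximally extended to the past) has past endpoint $\mathcal{O}$ if, after translating its parameter so that its domain begins at $0$, it extends continuously to parameter $0$ with value $\mathcal{O}$ there. Continuous extension to $M\cup\{\mathcal{O}\}$. $M\cup\{\mathcal{O}\}$ carries the subspace topology from $M_{\rm ext}$. A smooth function $f$ on $M$ extends continuously to $M\cup\{\mathcal{O}\}$ if there is a continuous $\widetilde f\colon M\cup\{\mathcal{O}\}\to\mathbb{R}$ with $\widetilde f|_M=f$; $\widetilde f$ is called the continuous extension of $f$. A smooth tensor on $M$ extends continuously to $M\cup\{\mathcal{O}\}$ if there is a coordinate neighborhood $U\subset M_{\rm ext}$ of $\mathcal{O}$ such that each component of the tensor in the coordinates on $U$ extends continuously to $(U\cap M)\cup\{\mathcal{O}\}$ (this does not depend on the coordinates). Strong causality. $(M_{\rm ext},g_{\rm ext})$ is strongly causal at $\mathcal{O}$ if for any neighborhood $U$ of $\mathcal{O}$ there is a neighborhood $V\subset U$ of $\mathcal{O}$ such that for every future directed causal curve $\gamma\colon[a,b]\to M_{\rm ext}$ with $\gamma(a),\gamma(b)\in V$ one has $\gamma([a,b])\subset U$. *)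

theory Defs
  imports "HOL-Analysis.Analysis"
begin

section \<open>Smooth functions on open subsets of Euclidean space\<close>

definition partial :: "'d \<Rightarrow> (real^'d::finite \<Rightarrow> 'b::real_normed_vector) \<Rightarrow> real^'d \<Rightarrow> 'b" where
  "partial i f x = frechet_derivative f (at x) (axis i 1)"

fun Ck_on :: "nat \<Rightarrow> (real^'d::finite \<Rightarrow> 'b::real_normed_vector) \<Rightarrow> (real^'d) set \<Rightarrow> bool" where
  "Ck_on 0 f S \<longleftrightarrow> continuous_on S f"
| "Ck_on (Suc k) f S \<longleftrightarrow> f differentiable_on S \<and> (\<forall>i. Ck_on k (partial i f) S)"

text \<open>Only used for open \<open>S\<close>; on other sets the partial derivatives taken at \<open>at x\<close>
  would not be the right notion.\<close>

definition smooth_on :: "(real^'d::finite) set \<Rightarrow> (real^'d \<Rightarrow> 'b::real_normed_vector) \<Rightarrow> bool" where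
  "smooth_on S f \<longleftrightarrow> (\<forall>k. Ck_on k f S)"


section \<open>Smooth manifolds\<close>

text \<open>A chart is a pair of an open domain and a coordinate map.  Coordinate maps are total
  functions, and their values outside the domain are irrelevant.  The dimension of the manifold is
  \<open>CARD('d)\<close>.\<close>

type_synonym ('a, 'd) chart = "'a set \<times> ('a \<Rightarrow> real^'d)"

definition chart_inv :: "('a, 'd::finite) chart \<Rightarrow> real^'d \<Rightarrow> 'a" where
  "chart_inv c = inv_into (fst c) (snd c)"

definition is_chart :: "('a::topological_space, 'd::finite) chart \<Rightarrow> bool" where
  "is_chart c \<longleftrightarrow> open (fst c) \<and> open (snd c ` fst c) \<and>
     homeomorphism (fst c) (snd c ` fst c) (snd c) (chart_inv c)"

definition transition :: "('a, 'd::finite) chart \<Rightarrow> ('a, 'd) chart \<Rightarrow> real^'d \<Rightarrow> real^'d" where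
  "transition c d = snd d \<circ> chart_inv c"

definition compatible :: "('a, 'd::finite) chart \<Rightarrow> ('a, 'd) chart \<Rightarrow> bool" where
  "compatible c d \<longleftrightarrow>
     smooth_on (snd c ` (fst c \<inter> fst d)) (transition c d) \<and>
     smooth_on (snd d ` (fst c \<inter> fst d)) (transition d c)"

text \<open>A connected smooth manifold whose underlying space is the open subset \<open>X\<close> of a Hausdorff,
  second countable space, with maximal smooth atlas \<open>A\<close>.\<close>

definition smooth_manifold ::
  "'a::{t2_space, second_countable_topology} set \<Rightarrow> ('a, 'd::finite) chart set \<Rightarrow> bool" where
  "smooth_manifold X A \<longleftrightarrow>
     open X \<and> connected X \<and> X \<noteq> {} \<and>
     (\<forall>c\<in>A. is_chart c \<and> fst c \<subseteq> X) \<and> (\<Union>c\<in>A. fst c) = X \<and>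
     (\<forall>c\<in>A. \<forall>d\<in>A. compatible c d) \<and>
     (\<forall>c. is_chart c \<and> fst c \<subseteq> X \<and> (\<forall>d\<in>A. compatible c d) \<longrightarrow> c \<in> A)"

definition restrict_atlas :: "('a, 'd) chart set \<Rightarrow> 'a set \<Rightarrow> ('a, 'd) chart set" where
  "restrict_atlas A M = {c \<in> A. fst c \<subseteq> M}"


section \<open>Vector fields and tensors\<close>

text \<open>A tensor field assigns to every chart its components at the points of the chart domain,
  subject to the usual transformation law between charts.\<close>

type_synonym ('a, 'd) vfield = "('a, 'd) chart \<Rightarrow> 'a \<Rightarrow> real^'d"
type_synonym ('a, 'd) tensor2 = "('a, 'd) chart \<Rightarrow> 'a \<Rightarrow> real^'d^'d"

definition vector_field :: "('a, 'd::finite) chart set \<Rightarrow> ('a, 'd) vfield \<Rightarrow> bool" where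
  "vector_field A u \<longleftrightarrow>
     (\<forall>c\<in>A. \<forall>d\<in>A. \<forall>q\<in>fst c \<inter> fst d.
        u d q = jacobian (transition c d) (at (snd c q)) *v u c q)"

definition covariant_tensor2 :: "('a, 'd::finite) chart set \<Rightarrow> ('a, 'd) tensor2 \<Rightarrow> bool" where
  "covariant_tensor2 A g \<longleftrightarrow>
     (\<forall>c\<in>A. \<forall>d\<in>A. \<forall>q\<in>fst c \<inter> fst d.
        g c q = transpose (jacobian (transition c d) (at (snd c q))) ** g d q
                  ** jacobian (transition c d) (at (snd c q)))"

definition smooth_components ::
  "('a, 'd::finite) chart set \<Rightarrow> (('a, 'd) chart \<Rightarrow> 'a \<Rightarrow> 'b::real_normed_vector) \<Rightarrow> bool" where
  "smooth_components A F \<longleftrightarrow> (\<forall>c\<in>A. smooth_on (snd c ` fst c) (F c \<circ> chart_inv c))"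

definition continuous_components ::
  "('a::topological_space, 'd::finite) chart set \<Rightarrow>
     (('a, 'd) chart \<Rightarrow> 'a \<Rightarrow> 'b::topological_space) \<Rightarrow> bool" where
  "continuous_components A F \<longleftrightarrow> (\<forall>c\<in>A. continuous_on (fst c) (F c))"

definition smooth_function :: "('a, 'd::finite) chart set \<Rightarrow> ('a \<Rightarrow> real) \<Rightarrow> bool" where
  "smooth_function A f \<longleftrightarrow> smooth_components A (\<lambda>_. f)"

definition bilin :: "real^'d^'d::finite \<Rightarrow> real^'d \<Rightarrow> real^'d \<Rightarrow> real" where
  "bilin G v w = (\<Sum>i\<in>UNIV. \<Sum>j\<in>UNIV. G $ i $ j * v $ i * w $ j)"


section \<open>Riemannian distance\<close>

definition riemannian_metric ::
  "('a, 'd::finite) chart set \<Rightarrow> ('a, 'd) tensor2 \<Rightarrow> bool" where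
  "riemannian_metric A h \<longleftrightarrow>
     covariant_tensor2 A h \<and> smooth_components A h \<and>
     (\<forall>c\<in>A. \<forall>q\<in>fst c. transpose (h c q) = h c q \<and> (\<forall>v. v \<noteq> 0 \<longrightarrow> bilin (h c q) v v > 0))"

definition C1_curve ::
  "('a::topological_space, 'd::finite) chart set \<Rightarrow> real \<Rightarrow> real \<Rightarrow> (real \<Rightarrow> 'a) \<Rightarrow> bool" where
  "C1_curve A a b \<gamma> \<longleftrightarrow> continuous_on {a..b} \<gamma> \<and> \<gamma> ` {a..b} \<subseteq> (\<Union>c\<in>A. fst c) \<and>
     (\<forall>c\<in>A. \<exists>D. continuous_on {t\<in>{a..b}. \<gamma> t \<in> fst c} D \<and>
        (\<forall>t\<in>{a..b}. \<gamma> t \<in> fst c \<longrightarrow>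
           ((snd c \<circ> \<gamma>) has_vector_derivative D t) (at t within {a..b})))"

text \<open>The speed does not depend on the chart chosen around \<open>\<gamma> t\<close>.\<close>

definition speed ::
  "('a::topological_space, 'd::finite) chart set \<Rightarrow> ('a, 'd) tensor2 \<Rightarrow> real \<Rightarrow> real \<Rightarrow>
     (real \<Rightarrow> 'a) \<Rightarrow> real \<Rightarrow> real" where
  "speed A h a b \<gamma> t =
     (let c = (SOME c. c \<in> A \<and> \<gamma> t \<in> fst c);
          v = vector_derivative (snd c \<circ> \<gamma>) (at t within {a..b})
      in sqrt (bilin (h c (\<gamma> t)) v v))"

text \<open>\<open>pw_C1_length A h x y l\<close>: there is a piecewise \<open>C\<^sup>1\<close> curve, i.e. a finite concatenation of
  \<open>C\<^sup>1\<close> curves, of length \<open>l\<close> from \<open>x\<close> to \<open>y\<close>.\<close>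

inductive pw_C1_length ::
  "('a::topological_space, 'd::finite) chart set \<Rightarrow> ('a, 'd) tensor2 \<Rightarrow> 'a \<Rightarrow> 'a \<Rightarrow> real \<Rightarrow> bool"
  for A h where
  C1: "a < b \<Longrightarrow> C1_curve A a b \<gamma> \<Longrightarrow>
         pw_C1_length A h (\<gamma> a) (\<gamma> b) (integral {a..b} (speed A h a b \<gamma>))"
| concat: "pw_C1_length A h x y l \<Longrightarrow> pw_C1_length A h y z l' \<Longrightarrow> pw_C1_length A h x z (l + l')"

definition riem_dist ::
  "('a::topological_space, 'd::finite) chart set \<Rightarrow> ('a, 'd) tensor2 \<Rightarrow> 'a \<Rightarrow> 'a \<Rightarrow> real" where
  "riem_dist A h x y = Inf {l. pw_C1_length A h x y l}"

definition complete_riemannian_metric ::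
  "('a::topological_space, 'd::finite) chart set \<Rightarrow> ('a, 'd) tensor2 \<Rightarrow> bool" where
  "complete_riemannian_metric A h \<longleftrightarrow> riemannian_metric A h \<and>
     (\<forall>x::nat \<Rightarrow> 'a. range x \<subseteq> (\<Union>c\<in>A. fst c) \<and>
        (\<forall>e>0. \<exists>N. \<forall>m\<ge>N. \<forall>k\<ge>N. riem_dist A h (x m) (x k) < e) \<longrightarrow>
        (\<exists>y\<in>\<Union>c\<in>A. fst c. (\<lambda>m. riem_dist A h (x m) y) \<longlonglongrightarrow> 0))"


section \<open>Spacetimes\<close>

definition lorentzian_form :: "real^'d^'d::finite \<Rightarrow> bool" where
  "lorentzian_form G \<longleftrightarrow> transpose G = G \<and>
     (\<exists>(P :: real^'d^'d) (k :: 'd). invertible P \<and>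
        transpose P ** G ** P =
          (\<chi> i j. if i \<noteq> j then 0 else if i = k then -1 else 1))"

definition lorentzian_metric ::
  "('a, 'd::finite) chart set \<Rightarrow> ('a, 'd) tensor2 \<Rightarrow> bool" where
  "lorentzian_metric A g \<longleftrightarrow>
     covariant_tensor2 A g \<and> (\<forall>c\<in>A. \<forall>q\<in>fst c. lorentzian_form (g c q))"

text \<open>The time orientation is given by a continuous timelike vector field \<open>T\<close>, declared to be future
  directed.\<close>

definition time_orientation ::
  "('a::topological_space, 'd::finite) chart set \<Rightarrow> ('a, 'd) tensor2 \<Rightarrow> ('a, 'd) vfield \<Rightarrow> bool" where
  "time_orientation A g T \<longleftrightarrow>
     vector_field A T \<and> continuous_components A T \<and>
     (\<forall>c\<in>A. \<forall>q\<in>fst c. bilin (g c q) (T c q) (T c q) < 0)"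

definition continuous_spacetime ::
  "'a::{t2_space, second_countable_topology} set \<Rightarrow> ('a, 'd::finite) chart set \<Rightarrow>
     ('a, 'd) tensor2 \<Rightarrow> ('a, 'd) vfield \<Rightarrow> bool" where
  "continuous_spacetime X A g T \<longleftrightarrow> smooth_manifold X A \<and>
     lorentzian_metric A g \<and> continuous_components A g \<and> time_orientation A g T"

definition smooth_spacetime ::
  "'a::{t2_space, second_countable_topology} set \<Rightarrow> ('a, 'd::finite) chart set \<Rightarrow>
     ('a, 'd) tensor2 \<Rightarrow> ('a, 'd) vfield \<Rightarrow> bool" where
  "smooth_spacetime X A g T \<longleftrightarrow> smooth_manifold X A \<and>
     lorentzian_metric A g \<and> smooth_components A g \<and> time_orientation A g T"

text \<open>The smooth spacetime is identified with its image \<open>M\<close> under the isometric embedding.  The image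
  is open by invariance of domain, and carries the restrictions of the smooth structure, the metric
  and the time orientation of the extension.  The underlying space of the extension is the whole
  type.\<close>

definition continuous_extension ::
  "('a::{t2_space, second_countable_topology}, 'd::finite) chart set \<Rightarrow> ('a, 'd) tensor2 \<Rightarrow>
     ('a, 'd) vfield \<Rightarrow> 'a set \<Rightarrow> bool" where
  "continuous_extension A g T M \<longleftrightarrow>
     continuous_spacetime UNIV A g T \<and> smooth_spacetime M (restrict_atlas A M) g T \<and> M \<subset> UNIV"


section \<open>Causal curves\<close>

definition timelike_vec :: "real^'d^'d::finite \<Rightarrow> real^'d \<Rightarrow> bool" where
  "timelike_vec G v \<longleftrightarrow> bilin G v v < 0"

definition causal_vec :: "real^'d^'d::finite \<Rightarrow> real^'d \<Rightarrow> bool" where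
  "causal_vec G v \<longleftrightarrow> v \<noteq> 0 \<and> bilin G v v \<le> 0"

text \<open>A causal vector \<open>v\<close> is future directed iff \<open>g(T, v) < 0\<close>.\<close>

definition future_vec :: "real^'d^'d::finite \<Rightarrow> real^'d \<Rightarrow> real^'d \<Rightarrow> bool" where
  "future_vec G t v \<longleftrightarrow> bilin G t v < 0"

definition lipschitz_curve ::
  "('a::topological_space, 'd::finite) chart set \<Rightarrow> real \<Rightarrow> real \<Rightarrow> (real \<Rightarrow> 'a) \<Rightarrow> bool" where
  "lipschitz_curve A a b \<gamma> \<longleftrightarrow> \<gamma> ` {a..b} \<subseteq> (\<Union>c\<in>A. fst c) \<and>
     (\<exists>h. complete_riemannian_metric A h \<and>
       (\<exists>L. \<forall>s\<in>{a..b}. \<forall>t\<in>{a..b}. riem_dist A h (\<gamma> s) (\<gamma> t) \<le> L * \<bar>s - t\<bar>))"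

definition locally_lipschitz_curve ::
  "('a::topological_space, 'd::finite) chart set \<Rightarrow> real \<Rightarrow> real \<Rightarrow> (real \<Rightarrow> 'a) \<Rightarrow> bool" where
  "locally_lipschitz_curve A a b \<gamma> \<longleftrightarrow> \<gamma> ` {a..b} \<subseteq> (\<Union>c\<in>A. fst c) \<and>
     (\<exists>h. complete_riemannian_metric A h \<and>
       (\<forall>r\<in>{a..b}. \<exists>e>0. \<exists>L. \<forall>s\<in>{a..b} \<inter> ball r e. \<forall>t\<in>{a..b} \<inter> ball r e.
          riem_dist A h (\<gamma> s) (\<gamma> t) \<le> L * \<bar>s - t\<bar>))"

text \<open>\<open>ae_velocity A a b \<gamma> P\<close>: for almost every \<open>t\<close> the velocity \<open>v\<close> of \<open>\<gamma>\<close> at \<open>t\<close> exists and its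
  components in every chart \<open>c\<close> around \<open>\<gamma> t\<close> satisfy \<open>P c (\<gamma> t) v\<close>.\<close>

definition ae_velocity ::
  "('a, 'd::finite) chart set \<Rightarrow> real \<Rightarrow> real \<Rightarrow> (real \<Rightarrow> 'a) \<Rightarrow>
     (('a, 'd) chart \<Rightarrow> 'a \<Rightarrow> real^'d \<Rightarrow> bool) \<Rightarrow> bool" where
  "ae_velocity A a b \<gamma> P \<longleftrightarrow>
     (AE t in lebesgue_on {a..b}. \<forall>c\<in>A. \<gamma> t \<in> fst c \<longrightarrow>
        (\<exists>v. ((snd c \<circ> \<gamma>) has_vector_derivative v) (at t within {a..b}) \<and> P c (\<gamma> t) v))"

definition fd_causal_curve ::
  "('a::topological_space, 'd::finite) chart set \<Rightarrow> ('a, 'd) tensor2 \<Rightarrow> ('a, 'd) vfield \<Rightarrow>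
     real \<Rightarrow> real \<Rightarrow> (real \<Rightarrow> 'a) \<Rightarrow> bool" where
  "fd_causal_curve A g T a b \<gamma> \<longleftrightarrow> a < b \<and> locally_lipschitz_curve A a b \<gamma> \<and>
     ae_velocity A a b \<gamma> (\<lambda>c q v. causal_vec (g c q) v \<and> future_vec (g c q) (T c q) v)"

definition fd_timelike_curve ::
  "('a::topological_space, 'd::finite) chart set \<Rightarrow> ('a, 'd) tensor2 \<Rightarrow> ('a, 'd) vfield \<Rightarrow>
     real \<Rightarrow> real \<Rightarrow> (real \<Rightarrow> 'a) \<Rightarrow> bool" where
  "fd_timelike_curve A g T a b \<gamma> \<longleftrightarrow> a < b \<and> lipschitz_curve A a b \<gamma> \<and>
     ae_velocity A a b \<gamma> (\<lambda>c q v. timelike_vec (g c q) v \<and> future_vec (g c q) (T c q) v) \<and>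
     (\<exists>\<epsilon>>0. ae_velocity A a b \<gamma> (\<lambda>c q v. bilin (g c q) v v < - \<epsilon>))"

definition timelike_future ::
  "('a::topological_space, 'd::finite) chart set \<Rightarrow> ('a, 'd) tensor2 \<Rightarrow> ('a, 'd) vfield \<Rightarrow>
     'a \<Rightarrow> 'a set" where
  "timelike_future A g T q = {\<gamma> b | \<gamma> a b. fd_timelike_curve A g T a b \<gamma> \<and> \<gamma> a = q}"

text \<open>\<open>J\<^sup>+(q, V)\<close>\<close>

definition causal_future ::
  "('a::topological_space, 'd::finite) chart set \<Rightarrow> ('a, 'd) tensor2 \<Rightarrow> ('a, 'd) vfield \<Rightarrow>
     'a \<Rightarrow> 'a set \<Rightarrow> 'a set" where
  "causal_future A g T q V =
     insert q {\<gamma> b | \<gamma> a b. fd_causal_curve A g T a b \<gamma> \<and> \<gamma> a = q \<and> \<gamma> ` {a..b} \<subseteq> V}"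

definition past_boundary ::
  "('a::topological_space, 'd::finite) chart set \<Rightarrow> ('a, 'd) tensor2 \<Rightarrow> ('a, 'd) vfield \<Rightarrow>
     'a set \<Rightarrow> 'a set" where
  "past_boundary A g T M =
     {q \<in> closure M - M. \<exists>\<gamma> a b. fd_timelike_curve A g T a b \<gamma> \<and> \<gamma> a = q \<and> \<gamma> ` {a<..b} \<subseteq> M}"

definition strongly_causal_at ::
  "('a::topological_space, 'd::finite) chart set \<Rightarrow> ('a, 'd) tensor2 \<Rightarrow> ('a, 'd) vfield \<Rightarrow>
     'a \<Rightarrow> bool" where
  "strongly_causal_at A g T z \<longleftrightarrow>
     (\<forall>U. open U \<and> z \<in> U \<longrightarrow>
       (\<exists>V. open V \<and> z \<in> V \<and> V \<subseteq> U \<and>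
         (\<forall>\<gamma> a b. fd_causal_curve A g T a b \<gamma> \<and> \<gamma> a \<in> V \<and> \<gamma> b \<in> V \<longrightarrow> \<gamma> ` {a..b} \<subseteq> U)))"


section \<open>Curvature\<close>

text \<open>The components of the Levi-Civita connection and its curvature in a chart \<open>c\<close>, as functions
  of the coordinates \<open>x\<close>.\<close>

definition metric_coord :: "('a, 'd::finite) tensor2 \<Rightarrow> ('a, 'd) chart \<Rightarrow> real^'d \<Rightarrow> real^'d^'d" where
  "metric_coord g c x = g c (chart_inv c x)"

text \<open>\<open>\<Gamma>\<^sup>k\<^sub>i\<^sub>j\<close>\<close>

definition christoffel ::
  "('a, 'd::finite) tensor2 \<Rightarrow> ('a, 'd) chart \<Rightarrow> 'd \<Rightarrow> 'd \<Rightarrow> 'd \<Rightarrow> real^'d \<Rightarrow> real" where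
  "christoffel g c k i j x =
     (1/2) * (\<Sum>l\<in>UNIV. matrix_inv (metric_coord g c x) $ k $ l *
       (partial i (\<lambda>y. metric_coord g c y $ j $ l) x
        + partial j (\<lambda>y. metric_coord g c y $ i $ l) x
        - partial l (\<lambda>y. metric_coord g c y $ i $ j) x))"

text \<open>\<open>R\<^sup>k\<^sub>l\<^sub>i\<^sub>j\<close>, where \<open>R(\<partial>\<^sub>i, \<partial>\<^sub>j) \<partial>\<^sub>l = R\<^sup>k\<^sub>l\<^sub>i\<^sub>j \<partial>\<^sub>k\<close> with
  \<open>R(X, Y) Z = \<nabla>\<^sub>X \<nabla>\<^sub>Y Z - \<nabla>\<^sub>Y \<nabla>\<^sub>X Z - \<nabla>\<^sub>[\<^sub>X\<^sub>,\<^sub>Y\<^sub>] Z\<close>.\<close>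

definition riemann ::
  "('a, 'd::finite) tensor2 \<Rightarrow> ('a, 'd) chart \<Rightarrow> 'd \<Rightarrow> 'd \<Rightarrow> 'd \<Rightarrow> 'd \<Rightarrow> real^'d \<Rightarrow> real" where
  "riemann g c k l i j x =
     partial i (christoffel g c k j l) x - partial j (christoffel g c k i l) x
     + (\<Sum>m\<in>UNIV. christoffel g c k i m x * christoffel g c m j l x
                 - christoffel g c k j m x * christoffel g c m i l x)"

text \<open>The sign convention is the one for which round spheres have positive Ricci curvature.\<close>

definition ricci :: "('a, 'd::finite) tensor2 \<Rightarrow> ('a, 'd) tensor2" where
  "ricci g c q = (\<chi> l j. \<Sum>k\<in>UNIV. riemann g c k l k j (snd c q))"

text \<open>The trace of the Ricci tensor does not depend on the chart chosen around \<open>q\<close>.\<close>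

definition scalar_curvature ::
  "('a, 'd::finite) chart set \<Rightarrow> ('a, 'd) tensor2 \<Rightarrow> 'a \<Rightarrow> real" where
  "scalar_curvature A g q =
     (let c = (SOME c. c \<in> A \<and> q \<in> fst c)
      in \<Sum>i\<in>UNIV. \<Sum>j\<in>UNIV. matrix_inv (g c q) $ i $ j * ricci g c q $ i $ j)"


section \<open>Perfect fluids\<close>

definition lower_index :: "('a, 'd::finite) tensor2 \<Rightarrow> ('a, 'd) vfield \<Rightarrow> ('a, 'd) vfield" where
  "lower_index g u c q = u c q v* g c q"

definition perfect_fluid ::
  "('a, 'd::finite) chart set \<Rightarrow> ('a, 'd) tensor2 \<Rightarrow> ('a, 'd) vfield \<Rightarrow>
     ('a, 'd) vfield \<Rightarrow> ('a \<Rightarrow> real) \<Rightarrow> ('a \<Rightarrow> real) \<Rightarrow> bool" where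
  "perfect_fluid A g T u \<rho> p \<longleftrightarrow>
     vector_field A u \<and> smooth_components A u \<and> smooth_function A \<rho> \<and> smooth_function A p \<and>
     (\<forall>c\<in>A. \<forall>q\<in>fst c. future_vec (g c q) (T c q) (u c q) \<and>
        bilin (g c q) (u c q) (u c q) = -1)"

definition einstein_perfect_fluid ::
  "('a, 'd::finite) chart set \<Rightarrow> ('a, 'd) tensor2 \<Rightarrow>
     ('a, 'd) vfield \<Rightarrow> ('a \<Rightarrow> real) \<Rightarrow> ('a \<Rightarrow> real) \<Rightarrow> bool" where
  "einstein_perfect_fluid A g u \<rho> p \<longleftrightarrow>
     (\<forall>c\<in>A. \<forall>q\<in>fst c. \<forall>i j.
        ricci g c q $ i $ j - 1/2 * scalar_curvature A g q * g c q $ i $ j =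
        8 * pi * ((\<rho> q + p q) * (lower_index g u c q $ i * lower_index g u c q $ j)
                  + p q * g c q $ i $ j))"

definition integral_curve ::
  "('a::topological_space, 'd::finite) chart set \<Rightarrow> ('a, 'd) vfield \<Rightarrow> real set \<Rightarrow>
     (real \<Rightarrow> 'a) \<Rightarrow> bool" where
  "integral_curve A u I \<gamma> \<longleftrightarrow> is_interval I \<and> interior I \<noteq> {} \<and>
     continuous_on I \<gamma> \<and> \<gamma> ` I \<subseteq> (\<Union>c\<in>A. fst c) \<and>
     (\<forall>t\<in>I. \<forall>c\<in>A. \<gamma> t \<in> fst c \<longrightarrow>
        ((snd c \<circ> \<gamma>) has_vector_derivative u c (\<gamma> t)) (at t within I))"

definition past_maximal_integral_curve ::
  "('a::topological_space, 'd::finite) chart set \<Rightarrow> ('a, 'd) vfield \<Rightarrow> real set \<Rightarrow>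
     (real \<Rightarrow> 'a) \<Rightarrow> bool" where
  "past_maximal_integral_curve A u I \<gamma> \<longleftrightarrow> integral_curve A u I \<gamma> \<and>
     \<not> (\<exists>I' \<gamma>'. integral_curve A u I' \<gamma>' \<and> I \<subseteq> I' \<and> (\<forall>t\<in>I. \<gamma>' t = \<gamma> t) \<and>
               (\<exists>s\<in>I'. \<forall>t\<in>I. s < t))"

text \<open>Translating the parameter so that the domain begins at \<open>0\<close> amounts to looking at the limit at
  the infimum of \<open>I\<close>.\<close>

definition has_past_endpoint :: "real set \<Rightarrow> (real \<Rightarrow> 'a::topological_space) \<Rightarrow> 'a \<Rightarrow> bool" where
  "has_past_endpoint I \<gamma> z \<longleftrightarrow>
     bdd_below I \<and> Inf I \<notin> I \<and> (\<gamma> \<longlongrightarrow> z) (at (Inf I) within I)"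


section \<open>Continuous extension to a boundary point\<close>

definition is_continuous_extension ::
  "'a::topological_space set \<Rightarrow> 'a \<Rightarrow> ('a \<Rightarrow> real) \<Rightarrow> ('a \<Rightarrow> real) \<Rightarrow> bool" where
  "is_continuous_extension S z f F \<longleftrightarrow> continuous_on (insert z S) F \<and> (\<forall>q\<in>S. F q = f q)"

definition extends_continuously ::
  "'a::topological_space set \<Rightarrow> 'a \<Rightarrow> ('a \<Rightarrow> real) \<Rightarrow> bool" where
  "extends_continuously S z f \<longleftrightarrow> (\<exists>F. is_continuous_extension S z f F)"

definition tensor_extends_continuously ::
  "('a::topological_space, 'd::finite) chart set \<Rightarrow> 'a set \<Rightarrow> 'a \<Rightarrow> ('a, 'd) tensor2 \<Rightarrow> bool" where
  "tensor_extends_continuously A M z S \<longleftrightarrow>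
     (\<exists>c\<in>A. z \<in> fst c \<and> (\<forall>i j. extends_continuously (fst c \<inter> M) z (\<lambda>q. S c q $ i $ j)))"

end

theory Submission
  imports Defs
begin

text \<open>
  Tracing the Einstein equations gives \<open>(n - 1) R = 16 \<pi> (\<rho> - n p)\<close>, so \<open>R\<close> extends to \<open>\<O>\<close> and the
  claim is \<open>\<rho> + p = 0\<close> at \<open>\<O>\<close>.  Otherwise the Einstein equations express \<open>u\<^sub>* \<otimes> u\<^sub>*\<close> near \<open>\<O>\<close>
  through continuous tensors, and \<open>u\<close> has a timelike limit \<open>w\<close> at \<open>\<O>\<close>.  In a chart around \<open>\<O>\<close>,
  follow the flow line through \<open>q = \<O> + \<delta> (w + E)\<close>, \<open>E\<close> a small vector orthogonal to \<open>w\<close>, back in time;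
  \<open>q\<close> lies in \<open>M = I\<^sup>+(\<O>)\<close>.  The flow line runs almost parallel to \<open>w\<close>.  If it ends at \<open>\<O>\<close> after
  a time at most \<open>3 \<delta>\<close>, it cannot have made up for the displacement \<open>\<delta> E\<close>.  If it lasts longer, it
  reaches a point of \<open>M\<close> in the timelike past of \<open>\<O>\<close>, whence \<open>\<O> \<in> I\<^sup>+(\<O>) = M\<close>.  Both are absurd.
\<close>

text \<open>The metric is merely continuous at \<O>, so there are no geodesics to work with there.
  Every timelike curve that is built is a straight coordinate segment, timelike because its
  direction is close to \<open>w\<close>; flow lines of \<open>u\<close> are compared with straight
  lines by the mean value inequality. \<open>E\<close> is orthogonal to \<open>w\<close> for the
  Euclidean inner product of the coordinates, not for \<open>g\<close>. Without \<open>E\<close>,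
  moving back along \<open>w\<close> for time \<delta> would lead exactly to \<O>. Going on to 3
  \<delta> leaves a chord of duration 2 \<delta> back to \<O>, over which the tilt due to
  \<open>E\<close> is halved; the drift up to that time must also stay below the displacement
  \<delta> \<open>E\<close>. A velocity error of a quarter of \<open>norm E\<close> meets both
  demands. Two obstacles account for much of the length. Lipschitz curves refer to a Riemannian
  distance that is an infimum of reals, so points must be joined by curves before the triangle
  inequality makes sense, and a complete metric has to be taken over from a curve already given. The
  endpoint hypothesis speaks of past-maximal integral curves, so one must be produced through each
  point of \<open>M\<close>.\<close>

section \<open>Calculus on open subsets of Euclidean space\<close>

lemma partial_cong:
  assumes "open S" "x \<in> S" "\<And>y. y \<in> S \<Longrightarrow> f y = g y"
  shows "partial i f x = partial i g x"
proof -
  have "(f has_derivative F) (at x) \<longleftrightarrow> (g has_derivative F) (at x)" for F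
    using has_derivative_transform_within_open[of f F x UNIV S g]
      has_derivative_transform_within_open[of g F x UNIV S f] assms by auto
  then show ?thesis unfolding partial_def frechet_derivative_def by simp
qed

lemma Ck_on_cong:
  assumes "open S" "\<And>y. y \<in> S \<Longrightarrow> f y = g y" "Ck_on k f S"
  shows "Ck_on k g S"
  using assms(2,3)
proof (induction k arbitrary: f g)
  case 0
  then show ?case using continuous_on_cong[of S S f g] by simp
next
  case (Suc k)
  have "g differentiable_on S"
    using Suc.prems has_derivative_transform_within_open[of f _ _ UNIV S g] assms(1)
    unfolding differentiable_on_eq_differentiable_at[OF \<open>open S\<close>] differentiable_def Ck_on.simps
    by blast
  moreover have "Ck_on k (partial i g) S" for i
    using Suc.IH[of "partial i f" "partial i g"] partial_cong[OF assms(1)] Suc.prems by auto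
  ultimately show ?case by simp
qed

lemma Ck_on_subset: "Ck_on k f S \<Longrightarrow> T \<subseteq> S \<Longrightarrow> Ck_on k f T"
  by (induction k arbitrary: f) (auto intro: continuous_on_subset differentiable_on_subset)

lemma smooth_on_subset_cong:
  assumes "smooth_on S f" "open T" "T \<subseteq> S" "\<And>y. y \<in> T \<Longrightarrow> f y = g y"
  shows "smooth_on T g"
  using assms Ck_on_cong[OF assms(2)] Ck_on_subset unfolding smooth_on_def by metis

lemma smooth_on_imp_continuous_on: "smooth_on S f \<Longrightarrow> continuous_on S f"
  unfolding smooth_on_def using Ck_on.simps(1) by blast

lemma smooth_on_imp_differentiable: "smooth_on S f \<Longrightarrow> open S \<Longrightarrow> x \<in> S \<Longrightarrow> f differentiable (at x)"
  unfolding smooth_on_def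
  using Ck_on.simps(2) differentiable_on_eq_differentiable_at by blast

lemma smooth_on_imp_continuous_on_partial: "smooth_on S f \<Longrightarrow> continuous_on S (partial i f)"
  unfolding smooth_on_def by (metis Ck_on.simps)

lemma jacobian_nth: "jacobian f (at x) $ i $ j = partial j f x $ i"
  by (simp add: jacobian_def matrix_def partial_def)

subsection \<open>Charts\<close>

lemma chart_inv_left: "is_chart c \<Longrightarrow> q \<in> fst c \<Longrightarrow> chart_inv c (snd c q) = q"
  unfolding is_chart_def homeomorphism_def by auto

lemma chart_inv_right: "is_chart c \<Longrightarrow> x \<in> snd c ` fst c \<Longrightarrow> snd c (chart_inv c x) = x"
  unfolding is_chart_def homeomorphism_def by auto

lemma chart_inv_in: "is_chart c \<Longrightarrow> x \<in> snd c ` fst c \<Longrightarrow> chart_inv c x \<in> fst c"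
  using chart_inv_left by fastforce

lemma continuous_on_chart: "is_chart c \<Longrightarrow> continuous_on (fst c) (snd c)"
  and continuous_on_chart_inv: "is_chart c \<Longrightarrow> continuous_on (snd c ` fst c) (chart_inv c)"
  unfolding is_chart_def homeomorphism_def by auto

lemma is_chart_opens: "is_chart c \<Longrightarrow> open (fst c)" "is_chart c \<Longrightarrow> open (snd c ` fst c)"
  unfolding is_chart_def by auto

lemma open_chart_image:
  assumes "is_chart c" "open U" "U \<subseteq> fst c"
  shows "open (snd c ` U)"
proof -
  have "openin (top_of_set (snd c ` fst c)) (snd c ` U)"
    using assms homeomorphism_imp_open_map[of "fst c" "snd c ` fst c" "snd c" "chart_inv c" U]
    by (auto simp: is_chart_def openin_open_eq)
  then show ?thesis using assms(1) by (simp add: is_chart_def openin_open_eq)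
qed

lemma transition_apply: "is_chart c \<Longrightarrow> q \<in> fst c \<Longrightarrow> transition c d (snd c q) = snd d q"
  by (simp add: transition_def chart_inv_left)

lemma open_overlap: "is_chart c \<Longrightarrow> is_chart d \<Longrightarrow> open (snd c ` (fst c \<inter> fst d))"
  by (rule open_chart_image) (auto simp: is_chart_def)

abbreviation trans_jac :: "('a, 'd::finite) chart \<Rightarrow> ('a, 'd) chart \<Rightarrow> 'a \<Rightarrow> real^'d^'d" where
  "trans_jac c d q \<equiv> jacobian (transition c d) (at (snd c q))"

lemma transition_has_derivative:
  assumes "is_chart c" "is_chart d" "compatible c d" "q \<in> fst c" "q \<in> fst d"
  shows "(transition c d has_derivative (\<lambda>h. trans_jac c d q *v h)) (at (snd c q))"
  using assms smooth_on_imp_differentiable[of "snd c ` (fst c \<inter> fst d)" "transition c d" "snd c q"]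
    open_overlap[of c d] jacobian_works unfolding compatible_def by blast

lemma continuous_on_trans_jac:
  assumes "is_chart c" "is_chart d" "compatible c d"
  shows "continuous_on (fst c \<inter> fst d) (trans_jac c d)"
proof -
  have "continuous_on (snd c ` (fst c \<inter> fst d)) (\<lambda>x. partial j (transition c d) x $ i)" for i j
    using assms(3) smooth_on_imp_continuous_on_partial continuous_on_component
    unfolding compatible_def by blast
  then have "continuous_on (snd c ` (fst c \<inter> fst d)) (\<lambda>x. jacobian (transition c d) (at x))"
    by (subst continuous_on_componentwise, auto simp: Basis_vec_def inner_axis jacobian_nth)
  moreover have "continuous_on (fst c \<inter> fst d) (snd c)"
    using continuous_on_chart[OF assms(1)] continuous_on_subset by blast
  ultimately show ?thesis using continuous_on_compose by (auto simp: o_def)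
qed

lemma curve_change_chart:
  assumes "is_chart c" "is_chart d" "compatible c d" "\<gamma> ` S \<subseteq> fst c" "t \<in> S" "\<gamma> t \<in> fst d"
    and "((snd c \<circ> \<gamma>) has_vector_derivative v) (at t within S)"
  shows "((snd d \<circ> \<gamma>) has_vector_derivative (trans_jac c d (\<gamma> t) *v v)) (at t within S)"
proof -
  have "(transition c d has_derivative (\<lambda>h. trans_jac c d (\<gamma> t) *v h))
      (at ((snd c \<circ> \<gamma>) t) within (snd c \<circ> \<gamma>) ` S)"
    using transition_has_derivative[of c d "\<gamma> t"] assms has_derivative_at_withinI by fastforce
  from vector_derivative_diff_chain_within[OF assms(7) this]
  have "((transition c d \<circ> (snd c \<circ> \<gamma>)) has_vector_derivative (trans_jac c d (\<gamma> t) *v v)) (at t within S)" .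
  moreover have "(transition c d \<circ> (snd c \<circ> \<gamma>)) s = (snd d \<circ> \<gamma>) s" if "s \<in> S" for s
    using transition_apply[OF assms(1), of "\<gamma> s" d] assms(4) that by auto
  ultimately show ?thesis
    using has_vector_derivative_transform[OF assms(5), of "snd d \<circ> \<gamma>" "transition c d \<circ> (snd c \<circ> \<gamma>)"]
    by simp
qed

lemma smooth_manifoldD:
  assumes "smooth_manifold X A"
  shows "c \<in> A \<Longrightarrow> is_chart c" "c \<in> A \<Longrightarrow> d \<in> A \<Longrightarrow> compatible c d" "(\<Union>c\<in>A. fst c) = X"
    "open X" "connected X"
proof -
  note a = assms[unfolded smooth_manifold_def]
  show "c \<in> A \<Longrightarrow> is_chart c" using a by blast
  show "c \<in> A \<Longrightarrow> d \<in> A \<Longrightarrow> compatible c d" using a by blast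
  show "(\<Union>c\<in>A. fst c) = X" "open X" "connected X" using a by blast+
qed

subsection \<open>Restriction of a chart\<close>

text \<open>The charts of \<open>M\<close> are the charts of the extension contained in
  \<open>M\<close>, and tensor components are indexed by charts. A chart around the boundary point
  sticks out of \<open>M\<close>, so it must be cut down before \<open>u\<close> and the Einstein
  equations can be read in it.\<close>

definition chart_restrict :: "('a, 'd) chart \<Rightarrow> 'a set \<Rightarrow> ('a, 'd) chart" where
  "chart_restrict c U = (fst c \<inter> U, snd c)"

lemma chart_restrict_simps [simp]:
  "fst (chart_restrict c U) = fst c \<inter> U" "snd (chart_restrict c U) = snd c"
  by (auto simp: chart_restrict_def)

lemma chart_inv_restrict:
  assumes "is_chart c" "x \<in> snd c ` (fst c \<inter> U)"
  shows "chart_inv (chart_restrict c U) x = chart_inv c x"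
proof -
  from assms(2) obtain q where q: "q \<in> fst c \<inter> U" "x = snd c q" by auto
  have "inj_on (snd c) (fst c \<inter> U)"
    using assms(1) chart_inv_left by (metis IntD1 inj_onI)
  then show ?thesis using q chart_inv_left[OF assms(1), of q]
    by (auto simp: chart_inv_def)
qed

lemma is_chart_restrict:
  assumes "is_chart c" "open U"
  shows "is_chart (chart_restrict c U)"
proof -
  have "homeomorphism (fst c) (snd c ` fst c) (snd c) (chart_inv c)"
    using assms unfolding is_chart_def by simp
  then have "homeomorphism (fst c \<inter> U) (snd c ` (fst c \<inter> U)) (snd c) (chart_inv c)"
    by (rule homeomorphism_of_subsets) auto
  then have "homeomorphism (fst c \<inter> U) (snd c ` (fst c \<inter> U)) (snd c) (chart_inv (chart_restrict c U))"
    by (rule homeomorphism_cong) (auto simp: chart_inv_restrict assms)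
  moreover have "open (fst c \<inter> U)" using assms by (auto simp: is_chart_def)
  ultimately show ?thesis
    using open_chart_image[of c "fst c \<inter> U"] assms unfolding is_chart_def by auto
qed

text \<open>Transition maps of the smaller chart are restrictions of those of \<open>c\<close>, so
  it is compatible with the atlas; maximality of the atlas then contains it.\<close>

lemma chart_restrict_in_atlas:
  assumes "smooth_manifold X A" "c \<in> A" "open U"
  shows "chart_restrict c U \<in> A"
proof -
  note D = smooth_manifoldD[OF assms(1)]
  have c: "is_chart c" "fst c \<subseteq> X" using assms D by auto
  have "compatible (chart_restrict c U) d" if d: "d \<in> A" for d
  proof -
    have cd: "compatible c d" "is_chart d" using D d assms by auto
    have "smooth_on (snd c ` (fst c \<inter> U \<inter> fst d)) (transition (chart_restrict c U) d)"
      using cd(1)[unfolded compatible_def, THEN conjunct1]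
    proof (rule smooth_on_subset_cong)
      show "open (snd c ` (fst c \<inter> U \<inter> fst d))"
        using open_chart_image[OF c(1), of "fst c \<inter> U \<inter> fst d"] cd c assms(3)
        by (auto simp: is_chart_def)
    qed (auto simp: transition_def chart_inv_restrict c)
    moreover have "smooth_on (snd d ` (fst c \<inter> U \<inter> fst d)) (transition d (chart_restrict c U))"
      using cd(1)[unfolded compatible_def, THEN conjunct2]
    proof (rule smooth_on_subset_cong)
      show "open (snd d ` (fst c \<inter> U \<inter> fst d))"
        using open_chart_image[OF cd(2), of "fst c \<inter> U \<inter> fst d"] cd c assms(3)
        by (auto simp: is_chart_def)
    qed (auto simp: transition_def)
    ultimately show ?thesis unfolding compatible_def by simp
  qed
  moreover have "is_chart (chart_restrict c U)" using is_chart_restrict c assms by blast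
  moreover have "fst (chart_restrict c U) \<subseteq> X" using c(2) by auto
  moreover have "\<forall>c. is_chart c \<and> fst c \<subseteq> X \<and> (\<forall>d\<in>A. compatible c d) \<longrightarrow> c \<in> A"
    using assms(1)[unfolded smooth_manifold_def] by (elim conjE)
  ultimately show ?thesis by blast
qed

text \<open>The transition map is the identity near \<open>snd c q\<close>. Through the
  transformation laws this makes tensor and vector components in both charts equal, which is not
  automatic since a field may a priori depend on the chart domain.\<close>

lemma trans_jac_restrict:
  assumes "is_chart c" "open U" "q \<in> fst c" "q \<in> U"
  shows "trans_jac c (chart_restrict c U) q = mat 1"
proof -
  have o: "open (snd c ` fst c)" "snd c q \<in> snd c ` fst c" using assms by (auto simp: is_chart_def)
  have "((\<lambda>x. x) has_derivative (\<lambda>h. h)) (at (snd c q))" by simp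
  then have "(transition c (chart_restrict c U) has_derivative (\<lambda>h. h)) (at (snd c q))"
    by (rule has_derivative_transform_within_open[OF _ o])
      (auto simp: transition_def chart_inv_left assms)
  then have "frechet_derivative (transition c (chart_restrict c U)) (at (snd c q)) = (\<lambda>h. h)"
    using frechet_derivative_at by metis
  then show ?thesis by (simp add: jacobian_def matrix_def mat_def axis_def vec_eq_iff)
qed

lemma covariant_tensor2_restrict:
  assumes "smooth_manifold X A" "covariant_tensor2 A g" "c \<in> A" "open U" "q \<in> fst c" "q \<in> U"
  shows "g (chart_restrict c U) q = g c q"
  using assms(2)[unfolded covariant_tensor2_def, rule_format,
      OF assms(3) chart_restrict_in_atlas[OF assms(1,3,4)], of q]
    trans_jac_restrict[of c U q] smooth_manifoldD(1)[OF assms(1,3)] assms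
  by (simp add: transpose_mat)

lemma vector_field_restrict:
  assumes "smooth_manifold X A" "vector_field A T" "c \<in> A" "open U" "q \<in> fst c" "q \<in> U"
  shows "T (chart_restrict c U) q = T c q"
  using assms(2)[unfolded vector_field_def, rule_format,
      OF assms(3) chart_restrict_in_atlas[OF assms(1,3,4)], of q]
    trans_jac_restrict[of c U q] smooth_manifoldD(1)[OF assms(1,3)] assms
  by simp

text \<open>\<open>ricci\<close> is given by a formula in each chart rather than by a transformation
  law. Both charts have the same coordinate map and the metric components agree on an open set, so
  the agreement passes to Christoffel symbols and their derivatives.\<close>

lemma ricci_restrict:
  assumes "smooth_manifold X A" "covariant_tensor2 A g" "c \<in> A" "open U" "q \<in> fst c" "q \<in> U"
  shows "ricci g (chart_restrict c U) q = ricci g c q"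
proof -
  let ?d = "chart_restrict c U" and ?S = "snd c ` (fst c \<inter> U)"
  have ch: "is_chart c" using smooth_manifoldD(1)[OF assms(1,3)] .
  have S: "open ?S" using open_chart_image[OF ch, of "fst c \<inter> U"] assms ch by (auto simp: is_chart_def)
  have m: "metric_coord g ?d x = metric_coord g c x" if "x \<in> ?S" for x
  proof -
    from that obtain r where r: "r \<in> fst c" "r \<in> U" "x = snd c r" by auto
    then show ?thesis
      using chart_inv_restrict[OF ch that] covariant_tensor2_restrict[OF assms(1-4) r(1,2)]
      by (simp add: metric_coord_def chart_inv_left ch)
  qed
  have ch: "christoffel g ?d k i j x = christoffel g c k i j x" if "x \<in> ?S" for k i j x
  proof -
    have "partial a (\<lambda>y. metric_coord g ?d y $ b $ e) x = partial a (\<lambda>y. metric_coord g c y $ b $ e) x" for a b e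
      by (rule partial_cong[OF S that]) (simp add: m)
    then show ?thesis unfolding christoffel_def by (simp add: m that)
  qed
  have "riemann g ?d k l i j (snd c q) = riemann g c k l i j (snd c q)" for k l i j
  proof -
    have q: "snd c q \<in> ?S" using assms by auto
    have "partial a (christoffel g ?d b e f) (snd c q) = partial a (christoffel g c b e f) (snd c q)" for a b e f
      by (rule partial_cong[OF S q]) (simp add: ch)
    then show ?thesis unfolding riemann_def by (simp add: ch q)
  qed
  then show ?thesis by (simp add: ricci_def)
qed

subsection \<open>Bilinear forms\<close>

lemma bilin_inner: "bilin G v w = v \<bullet> (G *v w)"
  by (simp add: bilin_def inner_vec_def matrix_vector_mult_def sum_distrib_left mult_ac)

lemma bilin_congruence: "bilin (transpose J ** G ** J) v w = bilin G (J *v v) (J *v w)"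
proof -
  have "v \<bullet> (transpose J *v z) = (J *v v) \<bullet> z" for z
    using dot_lmul_matrix[of z J v] by (simp add: inner_commute)
  then show ?thesis
    by (simp add: bilin_inner matrix_vector_mul_assoc[symmetric])
qed

lemma bilin_add: "bilin G (a + b) w = bilin G a w + bilin G b w"
  "bilin G w (a + b) = bilin G w a + bilin G w b"
  by (simp_all add: bilin_inner inner_left_distrib inner_right_distrib matrix_vector_right_distrib)

lemma bilin_scale: "bilin G (r *\<^sub>R a) w = r * bilin G a w" "bilin G w (r *\<^sub>R a) = r * bilin G w a"
  by (simp_all add: bilin_inner matrix_vector_mult_scaleR)

lemma bilin_sym: 
  assumes "transpose G = G" shows "bilin G v w = bilin G w v"
proof -
  have "G $ i $ j = G $ j $ i" for i j using assms by (metis transpose_def vec_lambda_beta)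
  then have "bilin G v w = (\<Sum>i\<in>UNIV. \<Sum>j\<in>UNIV. G $ j $ i * w $ j * v $ i)"
    unfolding bilin_def by (simp add: mult_ac)
  also have "\<dots> = bilin G w v" unfolding bilin_def by (rule sum.swap)
  finally show ?thesis .
qed

lemma tendsto_bilin [tendsto_intros]:
  assumes "(G \<longlongrightarrow> G0) F" "(v \<longlongrightarrow> v0) F" "(w \<longlongrightarrow> w0) F"
  shows "((\<lambda>x. bilin (G x) (v x) (w x)) \<longlongrightarrow> bilin G0 v0 w0) F"
  unfolding bilin_def by (intro tendsto_intros assms)

lemma continuous_on_bilin [continuous_intros]:
  assumes "continuous_on S G" "continuous_on S v" "continuous_on S w"
  shows "continuous_on S (\<lambda>x. bilin (G x) (v x) (w x))"
  using assms unfolding continuous_on_def by (auto intro: tendsto_bilin)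

lemma covariant_bilin:
  assumes "covariant_tensor2 A g" "c \<in> A" "d \<in> A" "q \<in> fst c" "q \<in> fst d"
  shows "bilin (g d q) (trans_jac c d q *v v) (trans_jac c d q *v w) = bilin (g c q) v w"
  using assms bilin_congruence unfolding covariant_tensor2_def by (metis IntI)

lemma minkowski_form:
  fixes k :: "'d::finite"
  defines "D \<equiv> (\<chi> i j. if i \<noteq> j then 0 else if i = k then -1 else 1) :: real^'d^'d"
  shows "D ** D = mat 1" "bilin D v w = (\<Sum>i\<in>UNIV-{k}. v $ i * w $ i) - v $ k * w $ k"
proof -
  let ?e = "\<lambda>i. if i = k then -1 else (1::real)"
  have s: "(\<Sum>l\<in>UNIV. D $ i $ l * h l) = ?e i * h i" for i and h :: "'d \<Rightarrow> real"
  proof -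
    have "(\<Sum>l\<in>UNIV. D $ i $ l * h l) = (\<Sum>l\<in>UNIV. if l = i then ?e i * h i else 0)"
      by (rule sum.cong) (auto simp: D_def)
    then show ?thesis by simp
  qed
  show "D ** D = mat 1"
    by (simp add: vec_eq_iff matrix_matrix_mult_def s) (simp add: D_def mat_def)
  have "bilin D v w = (\<Sum>i\<in>UNIV. v $ i * (\<Sum>j\<in>UNIV. D $ i $ j * w $ j))"
    unfolding bilin_def by (simp add: sum_distrib_left mult_ac)
  also have "\<dots> = (\<Sum>i\<in>UNIV. v $ i * (?e i * w $ i))" by (simp only: s)
  also have "\<dots> = v $ k * (?e k * w $ k) + (\<Sum>i\<in>UNIV-{k}. v $ i * (?e i * w $ i))"
    by (rule sum.remove) auto
  also have "(\<Sum>i\<in>UNIV-{k}. v $ i * (?e i * w $ i)) = (\<Sum>i\<in>UNIV-{k}. v $ i * w $ i)"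
    by (rule sum.cong) auto
  finally show "bilin D v w = (\<Sum>i\<in>UNIV-{k}. v $ i * w $ i) - v $ k * w $ k" by simp
qed

lemma lorentzian_form_det:
  assumes "lorentzian_form G"
  shows "det G \<noteq> 0"
proof -
  obtain P k where P: "transpose P ** G ** P =
          (\<chi> i j. if i \<noteq> j then 0 else if i = (k::'a) then -1 else (1::real))" (is "_ = ?D")
    using assms unfolding lorentzian_form_def by auto
  obtain D where D: "D = ?D" by simp
  have "D ** D = mat 1" unfolding D by (rule minkowski_form)
  then have "det D * det D = 1" by (simp flip: det_mul)
  then have "det D \<noteq> 0" by auto
  then have "det (transpose P ** G ** P) \<noteq> 0" by (simp only: P D not_False_eq_True)
  then show ?thesis by (simp add: det_mul)
qed

text \<open>In coordinates that diagonalize \<open>G\<close> this is Cauchy-Schwarz for the spatial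
  parts: orthogonality turns the spatial product into \<open>a' $ k * b' $ k\<close>, and the
  spatial part of \<open>a'\<close> is shorter than its time component, which can therefore be
  cancelled.\<close>

lemma lorentzian_orthogonal_timelike:
  assumes "lorentzian_form G" "bilin G a a < 0" "bilin G a b = 0"
  shows "bilin G b b \<ge> 0"
proof -
  obtain P k where inv: "invertible P" and P: "transpose P ** G ** P =
          (\<chi> i j. if i \<noteq> j then 0 else if i = (k::'a) then -1 else (1::real))" (is "_ = ?D")
    using assms unfolding lorentzian_form_def by auto
  obtain a' b' where ab: "a = P *v a'" "b = P *v b'"
    using inv by (metis invertible_def matrix_vector_mul_assoc matrix_vector_mul_lid)
  have D: "bilin ?D v w = (\<Sum>i\<in>UNIV-{k}. v $ i * w $ i) - v $ k * w $ k" for v w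
    by (rule minkowski_form)
  let ?S = "UNIV - {k}"
  have e: "bilin G (P *v v) (P *v w) = bilin ?D v w" for v w
    using bilin_congruence[of P G v w] P by simp
  have 1: "(\<Sum>i\<in>?S. (a' $ i)^2) < (a' $ k)^2"
    using assms(2) unfolding ab e D by (simp add: power2_eq_square)
  have 2: "(\<Sum>i\<in>?S. a' $ i * b' $ i) = a' $ k * b' $ k"
    using assms(3) unfolding ab e D by simp
  have "(a' $ k)^2 * (b' $ k)^2 \<le> (\<Sum>i\<in>?S. (a' $ i)^2) * (\<Sum>i\<in>?S. (b' $ i)^2)"
    using Cauchy_Schwarz_ineq_sum[of "\<lambda>i. a' $ i" "\<lambda>i. b' $ i" ?S] 2 by (simp add: power_mult_distrib)
  also have "\<dots> \<le> (a' $ k)^2 * (\<Sum>i\<in>?S. (b' $ i)^2)"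
    using 1 by (intro mult_right_mono) (auto intro: sum_nonneg)
  finally have "(b' $ k)^2 \<le> (\<Sum>i\<in>?S. (b' $ i)^2)"
    using 1 sum_nonneg[of ?S "\<lambda>i. (a' $ i)^2"] by (smt (verit) mult_le_cancel_left_pos zero_le_power2)
  then show ?thesis unfolding ab e D by (simp add: power2_eq_square)
qed

text \<open>Removing from \<open>b\<close> its component along \<open>a\<close> leaves a vector
  orthogonal to \<open>a\<close>, which cannot be timelike. Multiplying that inequality by the
  negative number \<open>bilin G a a\<close> gives the claim.\<close>

lemma reverse_Cauchy_Schwarz:
  assumes "lorentzian_form G" "bilin G a a < 0"
  shows "bilin G a a * bilin G b b \<le> (bilin G a b)\<^sup>2"
proof -
  let ?A = "bilin G a a" and ?B = "bilin G a b" and ?C = "bilin G b b"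
  have s: "bilin G b a = ?B" using assms(1) bilin_sym by (auto simp: lorentzian_form_def)
  define r where "r = - ?B / ?A"
  have rA: "r * ?A = - ?B" using assms by (simp add: r_def)
  have "bilin G a (b + r *\<^sub>R a) = 0" using rA by (simp add: bilin_add bilin_scale)
  from lorentzian_orthogonal_timelike[OF assms this]
  have "0 \<le> ?C + 2 * r * ?B + r * (r * ?A)" by (simp add: bilin_add bilin_scale s algebra_simps)
  then have "0 \<le> ?C + r * ?B" using rA by simp
  then have "?A * (?C + r * ?B) \<le> 0" using assms(2) by (simp add: mult_le_0_iff)
  then have "?A * ?C + (r * ?A) * ?B \<le> 0" by (simp add: algebra_simps)
  then show ?thesis using rA by (simp add: power2_eq_square)
qed

subsection \<open>Straight lines in a chart\<close>

definition coord_line :: "('a, 'd::finite) chart \<Rightarrow> real^'d \<Rightarrow> real^'d \<Rightarrow> real \<Rightarrow> 'a" where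
  "coord_line c x v t = chart_inv c (x + t *\<^sub>R v)"

locale in_chart_line =
  fixes X :: "'a::{t2_space, second_countable_topology} set" and A :: "('a, 'd::finite) chart set"
    and c :: "('a, 'd) chart" and x v :: "real^'d" and I :: "real set"
  assumes mf: "smooth_manifold X A" and cA: "c \<in> A"
    and inside: "t \<in> I \<Longrightarrow> x + t *\<^sub>R v \<in> snd c ` fst c"
begin

abbreviation "\<gamma> \<equiv> coord_line c x v"

lemma chart_c: "is_chart c" using smooth_manifoldD(1)[OF mf cA] .

lemma snd_line: "t \<in> I \<Longrightarrow> snd c (\<gamma> t) = x + t *\<^sub>R v"
  using chart_inv_right[OF chart_c inside] by (simp add: coord_line_def)

lemma line_in: "t \<in> I \<Longrightarrow> \<gamma> t \<in> fst c"
  using chart_inv_in[OF chart_c inside] by (simp add: coord_line_def)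

lemma continuous_line: "continuous_on I \<gamma>"
  unfolding coord_line_def
  by (rule continuous_on_compose2[OF continuous_on_chart_inv[OF chart_c]])
    (auto intro!: continuous_intros inside)

lemma line_deriv:
  assumes "t \<in> I" "d \<in> A" "\<gamma> t \<in> fst d"
  shows "((snd d \<circ> \<gamma>) has_vector_derivative (trans_jac c d (\<gamma> t) *v v)) (at t within I)"
proof (rule curve_change_chart[where c = c and S = I])
  show "is_chart c" "is_chart d" "compatible c d" "t \<in> I" "\<gamma> t \<in> fst d"
    using chart_c smooth_manifoldD[OF mf] cA assms by blast+
  show "\<gamma> ` I \<subseteq> fst c" using line_in by auto
  have "((\<lambda>t. x + t *\<^sub>R v) has_vector_derivative v) (at t within I)"
    by (auto intro!: derivative_eq_intros)
  then show "(snd c \<circ> \<gamma> has_vector_derivative v) (at t within I)"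
    by (rule has_vector_derivative_transform[OF assms(1), rotated]) (simp add: snd_line)
qed

lemma C1_curve_line:
  assumes "I = {a..b}"
  shows "C1_curve A a b \<gamma>"
proof -
  have "\<exists>D. continuous_on {t\<in>{a..b}. \<gamma> t \<in> fst d} D \<and>
        (\<forall>t\<in>{a..b}. \<gamma> t \<in> fst d \<longrightarrow> ((snd d \<circ> \<gamma>) has_vector_derivative D t) (at t within {a..b}))"
    if d: "d \<in> A" for d
  proof (intro exI conjI ballI impI)
    fix t assume "t \<in> {a..b}" "\<gamma> t \<in> fst d"
    then show "((snd d \<circ> \<gamma>) has_vector_derivative (trans_jac c d (\<gamma> t) *v v)) (at t within {a..b})"
      using line_deriv[OF _ d] assms by auto
  next
    have "continuous_on {t\<in>{a..b}. \<gamma> t \<in> fst d} (\<lambda>t. trans_jac c d (\<gamma> t))"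
      by (rule continuous_on_compose2[OF continuous_on_trans_jac[of c d]])
        (use chart_c d line_in assms smooth_manifoldD[OF mf] cA
          in \<open>auto intro: continuous_on_subset[OF continuous_line]\<close>)
    then show "continuous_on {t\<in>{a..b}. \<gamma> t \<in> fst d} (\<lambda>t. trans_jac c d (\<gamma> t) *v v)"
      unfolding matrix_vector_mult_def
      by (subst continuous_on_componentwise)
        (auto simp: Basis_vec_def inner_axis intro!: continuous_intros)
  qed
  moreover have "\<gamma> ` {a..b} \<subseteq> (\<Union>c\<in>A. fst c)" using line_in cA assms by blast
  ultimately show ?thesis
    using continuous_line assms by (simp add: C1_curve_def)
qed

lemma speed_line:
  assumes "I = {a..b}" "a < b" "t \<in> {a..b}" "covariant_tensor2 A h"
  shows "speed A h a b \<gamma> t = sqrt (bilin (h c (\<gamma> t)) v v)"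
proof -
  define d where "d = (SOME c. c \<in> A \<and> \<gamma> t \<in> fst c)"
  have d: "d \<in> A" "\<gamma> t \<in> fst d"
    using someI[of "\<lambda>c. c \<in> A \<and> \<gamma> t \<in> fst c" c] cA line_in assms unfolding d_def by auto
  have "((snd d \<circ> \<gamma>) has_vector_derivative (trans_jac c d (\<gamma> t) *v v)) (at t within {a..b})"
    using line_deriv[OF _ d] assms by auto
  then have "vector_derivative (snd d \<circ> \<gamma>) (at t within {a..b}) = trans_jac c d (\<gamma> t) *v v"
    using vector_derivative_within_closed_interval assms by blast
  then show ?thesis
    using covariant_bilin[OF assms(4) cA d(1), of "\<gamma> t" v v] line_in d assms
    unfolding speed_def d_def[symmetric] by (simp add: Let_def)
qed

end

subsection \<open>Riemannian distance\<close>

lemma speed_nonneg: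
  assumes "riemannian_metric A h" "\<gamma> t \<in> (\<Union>c\<in>A. fst c)"
  shows "speed A h a b \<gamma> t \<ge> 0"
proof -
  define d where "d = (SOME c. c \<in> A \<and> \<gamma> t \<in> fst c)"
  have d: "d \<in> A \<and> \<gamma> t \<in> fst d" unfolding d_def by (rule someI_ex) (use assms in auto)
  have "bilin (h d (\<gamma> t)) v v \<ge> 0" for v
    using assms d by (cases "v = 0") (auto simp: riemannian_metric_def bilin_def less_imp_le)
  then show ?thesis unfolding speed_def d_def[symmetric] by (simp add: Let_def)
qed

lemma pw_C1_length_nonneg:
  assumes "riemannian_metric A h" "pw_C1_length A h x y l"
  shows "l \<ge> 0"
  using assms(2)
proof induction
  case (C1 a b \<gamma>)
  have "speed A h a b \<gamma> t \<ge> 0" if "t \<in> {a..b}" for t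
    using speed_nonneg[OF assms(1)] C1 that unfolding C1_curve_def by blast
  \<comment> \<open>If the speed is not integrable, the integral is 0 by convention, which is still
    nonnegative.\<close>
  then show ?case
    by (cases "speed A h a b \<gamma> integrable_on {a..b}")
      (auto simp: not_integrable_integral intro: integral_nonneg)
qed auto

text \<open>Lengths are bounded below by 0, so the real infimum is a genuine lower bound.\<close>

lemma riem_dist_le:
  assumes "riemannian_metric A h" "pw_C1_length A h x y l"
  shows "riem_dist A h x y \<le> l"
  unfolding riem_dist_def
  by (rule cInf_lower) (use assms pw_C1_length_nonneg in \<open>auto intro!: bdd_belowI[of _ 0]\<close>)

text \<open>The two given lengths ensure that the infima on the right range over nonempty sets; the
  infimum of the empty set of reals would carry no information.\<close>

lemma riem_dist_triangle:
  assumes "riemannian_metric A h" "pw_C1_length A h x y l" "pw_C1_length A h y z l'"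
  shows "riem_dist A h x z \<le> riem_dist A h x y + riem_dist A h y z"
proof -
  have *: "riem_dist A h x z \<le> l1 + l2" if "pw_C1_length A h x y l1" "pw_C1_length A h y z l2" for l1 l2
    using riem_dist_le[OF assms(1)] pw_C1_length.concat that by fastforce
  have "riem_dist A h x z - l2 \<le> riem_dist A h x y" if "pw_C1_length A h y z l2" for l2
    unfolding riem_dist_def[of A h x y]
    by (rule cInf_greatest) (use assms(2) *[OF _ that] in \<open>auto simp: algebra_simps\<close>)
  then have "riem_dist A h x z - riem_dist A h x y \<le> riem_dist A h y z"
    unfolding riem_dist_def[of A h y z]
    by (intro cInf_greatest) (use assms(3) in \<open>auto simp: algebra_simps\<close>)
  then show ?thesis by simp
qed

lemma pw_C1_length_segment:
  assumes "smooth_manifold X A" "c \<in> A" "covariant_tensor2 A h"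
    and seg: "closed_segment x y \<subseteq> snd c ` fst c"
    and K: "\<And>z. z \<in> closed_segment x y \<Longrightarrow> bilin (h c (chart_inv c z)) (y - x) (y - x) \<le> K\<^sup>2" "K \<ge> 0"
  shows "\<exists>l\<le>K. pw_C1_length A h (chart_inv c x) (chart_inv c y) l"
proof -
  have z: "x + t *\<^sub>R (y - x) \<in> closed_segment x y" if "t \<in> {0..1}" for t
    using that by (auto simp: in_segment algebra_simps intro!: exI[of _ t])
  interpret in_chart_line X A c x "y - x" "{0..1}"
    by unfold_locales (use assms z in auto)
  have p: "pw_C1_length A h (\<gamma> 0) (\<gamma> 1) (integral {0..1} (speed A h 0 1 \<gamma>))"
    by (rule pw_C1_length.C1) (auto intro: C1_curve_line)
  have "speed A h 0 1 \<gamma> t \<le> K" if "t \<in> {0..1}" for t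
    using speed_line[OF refl _ that assms(3)] K(1)[OF z[OF that]] K(2)
    by (simp add: coord_line_def real_le_lsqrt)
  \<comment> \<open>Integrability of the speed need not be established: without it the integral is
    0, and \<open>K\<close> is nonnegative.\<close>
  then have "integral {0..1} (speed A h 0 1 \<gamma>) \<le> K"
  proof (cases "speed A h 0 1 \<gamma> integrable_on {0..1}")
    case True
    then have "integral {0..1} (speed A h 0 1 \<gamma>) \<le> integral {0..1} (\<lambda>t::real. K)"
      using \<open>\<And>t. t \<in> {0..1} \<Longrightarrow> speed A h 0 1 \<gamma> t \<le> K\<close> by (intro integral_le) auto
    then show ?thesis by simp
  qed (simp add: not_integrable_integral K)
  then show ?thesis using p by (auto simp: coord_line_def)
qed

lemma riem_continuous:
  assumes "riemannian_metric A h" "c \<in> A"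
  shows "continuous_on (snd c ` fst c) (\<lambda>x. h c (chart_inv c x))"
  using assms smooth_on_imp_continuous_on[of "snd c ` fst c" "h c \<circ> chart_inv c"]
  by (auto simp: riemannian_metric_def smooth_components_def o_def)

text \<open>The Lipschitz constant is the square root of a bound for \<open>h\<close> on the
  constant velocity \<open>v\<close> along the compact segment: the piece from \<open>s\<close> to
  \<open>t\<close>, run through in unit time, has velocity
  \<open>(t - s) *\<^sub>R v\<close>.\<close>

lemma riem_dist_line_lipschitz:
  assumes mf: "smooth_manifold X A" and c: "c \<in> A" and h: "riemannian_metric A h"
    and inside: "\<And>t. t \<in> {a..b} \<Longrightarrow> x + t *\<^sub>R v \<in> snd c ` fst c"
  shows "\<exists>L\<ge>0. \<forall>s\<in>{a..b}. \<forall>t\<in>{a..b}.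
    riem_dist A h (coord_line c x v s) (coord_line c x v t) \<le> L * \<bar>s - t\<bar>"
proof -
  have "continuous_on {a..b} (\<lambda>t. h c (chart_inv c (x + t *\<^sub>R v)))"
    by (rule continuous_on_compose2[OF riem_continuous[OF h c]])
      (auto intro!: continuous_intros inside)
  then have "continuous_on {a..b} (\<lambda>t. bilin (h c (chart_inv c (x + t *\<^sub>R v))) v v)" (is "continuous_on _ ?f")
    by (intro continuous_intros)
  then have "bounded (?f ` {a..b})" by (simp add: compact_continuous_image compact_imp_bounded)
  then obtain B where "\<forall>y\<in>?f ` {a..b}. norm y \<le> B" unfolding bounded_iff by blast
  then have B: "\<bar>?f t\<bar> \<le> B" if "t \<in> {a..b}" for t using that by auto
  \<comment> \<open>The absolute value keeps the constant nonnegative even if the interval is empty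
    and \<open>B\<close> is arbitrary.\<close>
  define K where "K = \<bar>B\<bar>"
  have K: "?f t \<le> K" "K \<ge> 0" if "t \<in> {a..b}" for t using B[OF that] by (auto simp: K_def)
  have "riem_dist A h (coord_line c x v s) (coord_line c x v t) \<le> sqrt K * \<bar>s - t\<bar>"
    if st: "s \<in> {a..b}" "t \<in> {a..b}" for s t
  proof -
    let ?p = "x + s *\<^sub>R v" and ?q = "x + t *\<^sub>R v"
    have pq: "?q - ?p = (t - s) *\<^sub>R v" by (simp add: algebra_simps)
    have on: "\<exists>r\<in>{a..b}. z = x + r *\<^sub>R v" if "z \<in> closed_segment ?p ?q" for z
    proof -
      obtain u where u: "0 \<le> u" "u \<le> 1" "z = (1 - u) *\<^sub>R ?p + u *\<^sub>R ?q"
        using \<open>z \<in> _\<close> unfolding in_segment by blast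
      have "z = x + ((1 - u) * s + u * t) *\<^sub>R v" using u by (simp add: algebra_simps)
      moreover have "(1 - u) * s + u * t \<in> {a..b}"
        using convexD_alt[of "{a..b}" s t u] st u by simp
      ultimately show ?thesis by blast
    qed
    have "\<exists>l\<le>sqrt K * \<bar>s - t\<bar>. pw_C1_length A h (chart_inv c ?p) (chart_inv c ?q) l"
    proof (rule pw_C1_length_segment[OF mf c])
      show "covariant_tensor2 A h" using h by (simp add: riemannian_metric_def)
      show "closed_segment ?p ?q \<subseteq> snd c ` fst c" using on inside by blast
      show "sqrt K * \<bar>s - t\<bar> \<ge> 0" using K st by auto
      fix z assume "z \<in> closed_segment ?p ?q"
      then obtain r where r: "r \<in> {a..b}" "z = x + r *\<^sub>R v" using on by blast
      have "bilin (h c (chart_inv c z)) (?q - ?p) (?q - ?p) = (t - s)\<^sup>2 * ?f r"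
        unfolding pq by (simp add: bilin_scale r power2_eq_square)
      also have "\<dots> \<le> (t - s)\<^sup>2 * K" using K[OF r(1)] by (intro mult_left_mono) auto
      also have "\<dots> = (sqrt K * \<bar>s - t\<bar>)\<^sup>2"
        using K[OF r(1)] by (simp add: power_mult_distrib power2_commute)
      finally show "bilin (h c (chart_inv c z)) (?q - ?p) (?q - ?p) \<le> (sqrt K * \<bar>s - t\<bar>)\<^sup>2" .
    qed
    then show ?thesis using riem_dist_le[OF h] unfolding coord_line_def by force
  qed
  moreover have "sqrt K \<ge> 0" by (simp add: K_def)
  ultimately show ?thesis by blast
qed

text \<open>Points of a coordinate ball are joined by segments, so the classes of joinable points
  are open, and connectedness leaves only one. This supplies the nonempty sets that
  \<open>riem_dist_triangle\<close> asks for.\<close>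

lemma pw_C1_connected:
  assumes mf: "smooth_manifold X A" and h: "riemannian_metric A h" and "p \<in> X" "q \<in> X"
  shows "\<exists>l. pw_C1_length A h p q l"
proof -
  note D = smooth_manifoldD[OF mf]
  \<comment> \<open>Asking for curves in both directions makes the relation symmetric without
    reversing curves.\<close>
  define R where "R p q \<longleftrightarrow> (\<exists>l. pw_C1_length A h p q l) \<and> (\<exists>l. pw_C1_length A h q p l)" for p q
  have "R p q"
  proof (rule connected_equivalence_relation[OF D(5) assms(3,4)])
    show "R y x" if "R x y" for x y using that by (auto simp: R_def)
    show "R x z" if "R x y" "R y z" for x y z using that pw_C1_length.concat unfolding R_def by blast
    fix a assume "a \<in> X"
    then obtain c where c: "c \<in> A" "a \<in> fst c" using D(3) by blast
    have ch: "is_chart c" using D c by auto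
    then have "open (snd c ` fst c)" by (simp add: is_chart_def)
    then obtain r where r: "r > 0" "cball (snd c a) r \<subseteq> snd c ` fst c"
      using c open_contains_cball[of "snd c ` fst c"] by auto
    define T where "T = fst c \<inter> snd c -` ball (snd c a) r"
    have T: "open T" unfolding T_def
      using continuous_on_chart[OF ch] ch by (auto simp: continuous_on_open_vimage is_chart_def Int_commute)
    have "\<exists>l. pw_C1_length A h y z l" if "y \<in> T" "z \<in> T" for y z
    proof -
      have yz: "y \<in> fst c" "z \<in> fst c" "snd c y \<in> cball (snd c a) r" "snd c z \<in> cball (snd c a) r"
        using that by (auto simp: T_def)
      have seg: "closed_segment (snd c y) (snd c z) \<subseteq> snd c ` fst c"
        using closed_segment_subset[OF yz(3,4) convex_cball] r by blast
      define f where "f = (\<lambda>w. bilin (h c (chart_inv c w)) (snd c z - snd c y) (snd c z - snd c y))"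
      have "continuous_on (closed_segment (snd c y) (snd c z)) f"
        unfolding f_def
        by (intro continuous_intros continuous_on_subset[OF riem_continuous[OF h c(1)] seg])
      then have "bounded (f ` closed_segment (snd c y) (snd c z))"
        by (simp add: compact_continuous_image compact_imp_bounded)
      then obtain B where "\<forall>y\<in>f ` closed_segment (snd c y) (snd c z). norm y \<le> B"
        unfolding bounded_iff by blast
      then have B: "\<bar>f w\<bar> \<le> B" if "w \<in> closed_segment (snd c y) (snd c z)" for w using that by auto
      have "f w \<le> (sqrt \<bar>B\<bar>)\<^sup>2" if "w \<in> closed_segment (snd c y) (snd c z)" for w
        using B[OF that] by simp
      then have "\<exists>l\<le>sqrt \<bar>B\<bar>. pw_C1_length A h (chart_inv c (snd c y)) (chart_inv c (snd c z)) l"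
        by (intro pw_C1_length_segment[OF mf c(1) _ seg])
          (use h in \<open>auto simp: f_def riemannian_metric_def\<close>)
      then show ?thesis using chart_inv_left[OF ch] yz by auto
    qed
    moreover have "a \<in> T" using c r by (simp add: T_def)
    moreover have "openin (top_of_set X) T"
      using T D(3) c by (subst openin_open_eq[OF D(4)]) (auto simp: T_def)
    ultimately show "\<exists>T. openin (top_of_set X) T \<and> a \<in> T \<and> (\<forall>x\<in>T. R a x)"
      unfolding R_def by blast
  qed
  then show ?thesis by (simp add: R_def)
qed

subsection \<open>Concatenation of timelike curves\<close>

text \<open>Away from the junction \<open>b\<close> the derivative within the long interval depends
  on one piece only, and the junction itself is a null set.\<close>

lemma ae_velocity_concat:
  assumes "ae_velocity A a b \<gamma>1 P" "ae_velocity A b e \<gamma>2 P" "\<gamma>1 b = \<gamma>2 b" "a < b" "b < e"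
  shows "ae_velocity A a e (\<lambda>t. if t \<le> b then \<gamma>1 t else \<gamma>2 t) P"
proof -
  let ?\<gamma> = "\<lambda>t. if t \<le> b then \<gamma>1 t else \<gamma>2 t"
  have iff: "ae_velocity A a b \<gamma> P \<longleftrightarrow> (AE t in lebesgue. t \<in> {a..b} \<longrightarrow> (\<forall>c\<in>A. \<gamma> t \<in> fst c \<longrightarrow>
        (\<exists>v. ((snd c \<circ> \<gamma>) has_vector_derivative v) (at t within {a..b}) \<and> P c (\<gamma> t) v)))" for a b \<gamma>
    unfolding ae_velocity_def by (rule AE_restrict_space_iff) simp
  have "AE t in lebesgue. t \<noteq> b" using AE_completion[OF AE_lborel_singleton[of b]] .
  with assms(1,2)[unfolded iff] show ?thesis unfolding iff
  proof eventually_elim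
    case (elim t)
    show ?case
    proof (intro impI ballI)
      fix c assume t: "t \<in> {a..e}" and c: "c \<in> A" "?\<gamma> t \<in> fst c"
      show "\<exists>v. ((snd c \<circ> ?\<gamma>) has_vector_derivative v) (at t within {a..e}) \<and> P c (?\<gamma> t) v"
      proof (cases "t < b")
        case True
        then obtain v where v: "((snd c \<circ> \<gamma>1) has_vector_derivative v) (at t within {a..b})" "P c (\<gamma>1 t) v"
          using elim(1) t c by auto
        have "at t within {a..b} = at t within {a..e}"
          by (rule at_within_nhd[of t "{..<b}"]) (use True assms in auto)
        with v(1) have "((snd c \<circ> \<gamma>1) has_vector_derivative v) (at t within {a..e})" by simp
        then have "((snd c \<circ> ?\<gamma>) has_vector_derivative v) (at t within {a..e})"
          by (rule has_vector_derivative_transform_within[of _ _ _ _ "b - t"])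
            (use True t in \<open>auto simp: dist_real_def\<close>)
        then show ?thesis using v True by auto
      next
        case False
        then have b: "t > b" using elim(3) by auto
        then obtain v where v: "((snd c \<circ> \<gamma>2) has_vector_derivative v) (at t within {b..e})" "P c (\<gamma>2 t) v"
          using elim(2) t c by auto
        have "at t within {b..e} = at t within {a..e}"
          by (rule at_within_nhd[of t "{b<..}"]) (use b assms in auto)
        with v(1) have "((snd c \<circ> \<gamma>2) has_vector_derivative v) (at t within {a..e})" by simp
        then have "((snd c \<circ> ?\<gamma>) has_vector_derivative v) (at t within {a..e})"
          by (rule has_vector_derivative_transform_within[of _ _ _ _ "t - b"])
            (use b t in \<open>auto simp: dist_real_def\<close>)
        then show ?thesis using v b by auto
      qed
    qed
  qed
qed

lemma ae_velocity_mono: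
  assumes "ae_velocity A a b \<gamma> P" "\<And>c q v. c \<in> A \<Longrightarrow> P c q v \<Longrightarrow> Q c q v"
  shows "ae_velocity A a b \<gamma> Q"
  using assms(1) unfolding ae_velocity_def
  by (rule AE_mp) (intro AE_I2, use assms(2) in blast)

section \<open>Coordinate segments as timelike curves\<close>

text \<open>The velocity is the constant \<open>v\<close> in \<open>c\<close> only; in any other
  chart it is the Jacobian image of \<open>v\<close>, and the transformation laws of
  \<open>g\<close> and \<open>T\<close> carry both inequalities over.\<close>

lemma line_velocity:
  assumes mf: "smooth_manifold X A" and g: "covariant_tensor2 A g" and T: "vector_field A T" and c: "c \<in> A"
    and inside: "\<And>t. t \<in> {a..b} \<Longrightarrow> x + t *\<^sub>R v \<in> snd c ` fst c"
    and tl: "\<And>t. t \<in> {a..b} \<Longrightarrow> bilin (g c (coord_line c x v t)) v v < - \<epsilon>"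
    and fut: "\<And>t. t \<in> {a..b} \<Longrightarrow> bilin (g c (coord_line c x v t)) (T c (coord_line c x v t)) v < 0"
  shows "ae_velocity A a b (coord_line c x v) (\<lambda>c q w. bilin (g c q) w w < - \<epsilon> \<and> future_vec (g c q) (T c q) w)"
  unfolding ae_velocity_def
proof (intro AE_I2 ballI impI)
  interpret in_chart_line X A c x v "{a..b}"
    by unfold_locales (use assms in auto)
  fix t d assume "t \<in> space (lebesgue_on {a..b})" and d: "d \<in> A" "coord_line c x v t \<in> fst d"
  then have t: "t \<in> {a..b}" by simp
  let ?q = "coord_line c x v t"
  have q: "?q \<in> fst c" using line_in[OF t] .
  have "T d ?q = trans_jac c d ?q *v T c ?q"
    using T[unfolded vector_field_def, rule_format, OF c d(1) IntI[OF q d(2)]] .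
  then have "bilin (g d ?q) (T d ?q) (trans_jac c d ?q *v v) = bilin (g c ?q) (T c ?q) v"
    using covariant_bilin[OF g c d(1) q d(2)] by simp
  then show "\<exists>w. ((snd d \<circ> coord_line c x v) has_vector_derivative w) (at t within {a..b}) \<and>
     (bilin (g d ?q) w w < - \<epsilon> \<and> future_vec (g d ?q) (T d ?q) w)"
    using line_deriv[OF t d] covariant_bilin[OF g c d(1) q d(2), of v v] tl[OF t] fut[OF t]
    by (intro exI[of _ "trans_jac c d ?q *v v"]) (auto simp: future_vec_def)
qed

context
  fixes A :: "('a::{t2_space, second_countable_topology}, 'd::finite) chart set"
    and g :: "('a, 'd) tensor2" and T :: "('a, 'd) vfield" and c :: "('a, 'd) chart"
    and x v :: "real^'d" and a b \<epsilon> :: real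
  assumes mf: "smooth_manifold UNIV A" and g: "covariant_tensor2 A g" and T: "vector_field A T"
    and c: "c \<in> A"
    and inside: "\<And>t. t \<in> {a..b} \<Longrightarrow> x + t *\<^sub>R v \<in> snd c ` fst c"
    and tl: "\<And>t. t \<in> {a..b} \<Longrightarrow> bilin (g c (coord_line c x v t)) v v < - \<epsilon>"
    and fut: "\<And>t. t \<in> {a..b} \<Longrightarrow> bilin (g c (coord_line c x v t)) (T c (coord_line c x v t)) v < 0"
    and ab: "a < b" "\<epsilon> > 0"
begin

lemma fd_timelike_line:
  assumes "complete_riemannian_metric A h"
  shows "fd_timelike_curve A g T a b (coord_line c x v)"
proof -
  note V = line_velocity[OF mf g T c inside tl fut]
  have "lipschitz_curve A a b (coord_line c x v)"
    using riem_dist_line_lipschitz[OF mf c _ inside, of h a b] assms smooth_manifoldD(3)[OF mf]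
    unfolding lipschitz_curve_def complete_riemannian_metric_def by (metis top_greatest)
  moreover have "ae_velocity A a b (coord_line c x v)
      (\<lambda>c q v. timelike_vec (g c q) v \<and> future_vec (g c q) (T c q) v)"
    by (rule ae_velocity_mono[OF V]) (use ab in \<open>auto simp: timelike_vec_def\<close>)
  moreover have "ae_velocity A a b (coord_line c x v) (\<lambda>c q v. bilin (g c q) v v < - \<epsilon>)"
    by (rule ae_velocity_mono[OF V]) auto
  ultimately show ?thesis using ab unfolding fd_timelike_curve_def by blast
qed

text \<open>The complete metric is the one that comes with the given curve. A coordinate segment is
  Lipschitz for every Riemannian metric, hence for this one, and the triangle inequality through the
  junction settles pairs of parameters on different pieces.\<close>

lemma fd_timelike_concat_line:
  assumes \<gamma>: "fd_timelike_curve A g T s a \<gamma>" and ends: "\<gamma> a = coord_line c x v a"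
  shows "fd_timelike_curve A g T s b (\<lambda>t. if t \<le> a then \<gamma> t else coord_line c x v t)"
    (is "fd_timelike_curve A g T s b ?\<gamma>")
proof -
  let ?l = "coord_line c x v"
  have sa: "s < a" using \<gamma> by (simp add: fd_timelike_curve_def)
  have U: "(\<Union>c\<in>A. fst c) = UNIV" using smooth_manifoldD(3)[OF mf] .
  obtain h L where h: "complete_riemannian_metric A h"
    and L: "\<And>p q. p \<in> {s..a} \<Longrightarrow> q \<in> {s..a} \<Longrightarrow> riem_dist A h (\<gamma> p) (\<gamma> q) \<le> L * \<bar>p - q\<bar>"
    using \<gamma> unfolding fd_timelike_curve_def lipschitz_curve_def by metis
  have hr: "riemannian_metric A h" using h by (simp add: complete_riemannian_metric_def)
  obtain K where K: "K \<ge> 0"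
    "\<And>p q. p \<in> {a..b} \<Longrightarrow> q \<in> {a..b} \<Longrightarrow> riem_dist A h (?l p) (?l q) \<le> K * \<bar>p - q\<bar>"
    using riem_dist_line_lipschitz[OF mf c hr inside, of a b] by metis
  define B where "B = max \<bar>L\<bar> K"
  have B: "L \<le> B" "K \<le> B" by (auto simp: B_def)
  have tri: "riem_dist A h p r \<le> riem_dist A h p q + riem_dist A h q r" for p q r
    using riem_dist_triangle[OF hr] pw_C1_connected[OF mf hr] by (metis UNIV_I)
  have le: "riem_dist A h (\<gamma> p) (\<gamma> q) \<le> B * \<bar>p - q\<bar>" if "p \<in> {s..a}" "q \<in> {s..a}" for p q
    using L[OF that] mult_right_mono[OF B(1), of "\<bar>p - q\<bar>"] by linarith
  have le2: "riem_dist A h (?l p) (?l q) \<le> B * \<bar>p - q\<bar>" if "p \<in> {a..b}" "q \<in> {a..b}" for p q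
    using K(2)[OF that] mult_right_mono[OF B(2), of "\<bar>p - q\<bar>"] by linarith
  have "riem_dist A h (?\<gamma> p) (?\<gamma> q) \<le> B * \<bar>p - q\<bar>" if p: "p \<in> {s..b}" and q: "q \<in> {s..b}" for p q
  proof (cases "p \<le> a"; cases "q \<le> a")
    assume "p \<le> a" "q \<le> a"
    then show ?thesis using le p q by simp
  next
    assume "\<not> p \<le> a" "\<not> q \<le> a"
    then show ?thesis using le2 p q by simp
  next
    assume pq: "p \<le> a" "\<not> q \<le> a"
    then have "riem_dist A h (\<gamma> p) (\<gamma> a) \<le> B * (a - p)" "riem_dist A h (?l a) (?l q) \<le> B * (q - a)"
      using le[of p a] le2[of a q] p q ab sa by auto
    then show ?thesis using tri[of "\<gamma> p" "?l q" "\<gamma> a"] pq ends by (simp add: algebra_simps)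
  next
    assume pq: "\<not> p \<le> a" "q \<le> a"
    then have "riem_dist A h (\<gamma> a) (\<gamma> q) \<le> B * (a - q)" "riem_dist A h (?l p) (?l a) \<le> B * (p - a)"
      using le[of a q] le2[of p a] p q ab sa by auto
    then show ?thesis using tri[of "?l p" "\<gamma> q" "\<gamma> a"] pq ends by (simp add: algebra_simps)
  qed
  then have lip: "lipschitz_curve A s b ?\<gamma>"
    using h U unfolding lipschitz_curve_def by blast
  note V = line_velocity[OF mf g T c inside tl fut]
  have Vl: "ae_velocity A a b ?l (\<lambda>c q v. timelike_vec (g c q) v \<and> future_vec (g c q) (T c q) v)"
    by (rule ae_velocity_mono[OF V]) (use ab in \<open>auto simp: timelike_vec_def\<close>)
  obtain \<epsilon>' where e': "\<epsilon>' > 0" "ae_velocity A s a \<gamma> (\<lambda>c q v. bilin (g c q) v v < - \<epsilon>')"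
    using \<gamma> unfolding fd_timelike_curve_def by blast
  have "ae_velocity A s b ?\<gamma> (\<lambda>c q v. timelike_vec (g c q) v \<and> future_vec (g c q) (T c q) v)"
    by (rule ae_velocity_concat[where ?\<gamma>1.0 = \<gamma>, OF _ Vl ends sa ab(1)]) (use \<gamma> in \<open>simp add: fd_timelike_curve_def\<close>)
  moreover have "ae_velocity A s b ?\<gamma> (\<lambda>c q v. bilin (g c q) v v < - min \<epsilon> \<epsilon>')"
    by (rule ae_velocity_concat[where ?\<gamma>1.0 = \<gamma>, OF ae_velocity_mono[OF e'(2)] ae_velocity_mono[OF V] ends sa ab(1)]) auto
  moreover have "min \<epsilon> \<epsilon>' > 0" using ab e' by simp
  ultimately show ?thesis using lip sa ab unfolding fd_timelike_curve_def by (meson less_trans)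
qed

end

subsection \<open>Existence of integral curves\<close>

text \<open>The partial derivatives are bounded on the compact ball, and the ball is convex, so the
  mean value inequality applies.\<close>

lemma smooth_on_lipschitz_cball:
  fixes f :: "real^'d::finite \<Rightarrow> 'b::real_normed_vector"
  assumes f: "smooth_on S f" and S: "open S" "cball x r \<subseteq> S"
  shows "\<exists>K\<ge>0. \<forall>y\<in>cball x r. \<forall>z\<in>cball x r. norm (f y - f z) \<le> K * norm (y - z)"
proof -
  have "\<exists>B\<ge>0. \<forall>y\<in>cball x r. norm (partial i f y) \<le> B" for i
  proof -
    have "continuous_on (cball x r) (partial i f)"
      using smooth_on_imp_continuous_on_partial[OF f] S continuous_on_subset by blast
    then have "bounded (partial i f ` cball x r)"
      by (intro compact_imp_bounded compact_continuous_image compact_cball)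
    then show ?thesis unfolding bounded_pos using less_imp_le by blast
  qed
  then obtain B where B: "\<And>i. B i \<ge> 0" "\<And>i y. y \<in> cball x r \<Longrightarrow> norm (partial i f y) \<le> B i"
    by metis
  define K where "K = (\<Sum>i\<in>UNIV. B i)"
  have "norm (f y - f z) \<le> K * norm (y - z)" if "y \<in> cball x r" "z \<in> cball x r" for y z
  proof (rule differentiable_bound[OF convex_cball _ _ that])
    fix y assume y: "y \<in> cball x r"
    then have d: "(f has_derivative frechet_derivative f (at y)) (at y)"
      using smooth_on_imp_differentiable[OF f S(1)] S(2) frechet_derivative_works by blast
    then show "(f has_derivative frechet_derivative f (at y)) (at y within cball x r)"
      by (rule has_derivative_at_withinI)
    have lin: "linear (frechet_derivative f (at y))"
      using d has_derivative_linear by blast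
    show "onorm (frechet_derivative f (at y)) \<le> K"
    proof (rule onorm_le)
      fix h :: "real^'d"
      have "h = (\<Sum>i\<in>UNIV. h $ i *\<^sub>R axis i 1)"
        using basis_expansion[of h] by (simp add: scalar_mult_eq_scaleR)
      then have "frechet_derivative f (at y) h = (\<Sum>i\<in>UNIV. h $ i *\<^sub>R partial i f y)"
        using linear_sum[OF lin, of "\<lambda>i. h $ i *\<^sub>R axis i 1" UNIV] linear_scale[OF lin]
        by (simp add: partial_def)
      also have "norm \<dots> \<le> (\<Sum>i\<in>UNIV. norm h * B i)"
      proof (rule sum_norm_le)
        fix i show "norm (h $ i *\<^sub>R partial i f y) \<le> norm h * B i"
          using component_le_norm_cart[of h i] B(2)[OF y, of i] by (auto intro: mult_mono)
      qed
      finally show "norm (frechet_derivative f (at y) h) \<le> K * norm h"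
        by (simp add: K_def sum_distrib_left mult.commute)
    qed
  qed
  moreover have "K \<ge> 0" using B by (simp add: K_def sum_nonneg)
  ultimately show ?thesis by blast
qed

text \<open>Picard iteration is a contraction with factor \<open>K * \<eta>\<close> for the supremum
  distance. A globally bounded and Lipschitz field spares any control of where the iterates
  go.\<close>

lemma picard_global:
  fixes F :: "'b::euclidean_space \<Rightarrow> 'b"
  assumes lip: "\<And>x y. norm (F x - F y) \<le> K * norm (x - y)" and bd: "\<And>x. norm (F x) \<le> B"
    and "K \<ge> 0" "\<eta> > 0" "K * \<eta> < 1"
  shows "\<exists>z. z 0 = x0 \<and> (\<forall>t\<in>{0..\<eta>}. norm (z t - x0) \<le> B * t \<and>
    (z has_vector_derivative F (z t)) (at t within {0..\<eta>}))"
proof -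
  have contF: "continuous_on UNIV F"
  proof (rule continuous_onI)
    fix x and e :: real assume e: "e > 0"
    show "\<exists>d>0. \<forall>x'\<in>UNIV. dist x' x < d \<longrightarrow> dist (F x') (F x) \<le> e"
    proof (intro exI conjI ballI impI)
      show "e / (K + 1) > 0" using e assms by simp
      fix x' assume "dist x' x < e / (K + 1)"
      then have "(K + 1) * dist x' x < e" using assms by (simp add: field_simps)
      then show "dist (F x') (F x) \<le> e"
        using lip[of x' x] assms by (simp add: dist_norm algebra_simps) (smt (verit) norm_ge_zero)
    qed
  qed
  \<comment> \<open>Clamping time to the interval turns the Picard operator into a self-map of the
    bounded continuous functions on the whole real line, a complete metric space given as a
    type.\<close>
  define cl where "cl t = max 0 (min t \<eta>)" for t :: real
  have cl: "cl t \<in> {0..\<eta>}" "t \<in> {0..\<eta>} \<Longrightarrow> cl t = t" for t using assms by (auto simp: cl_def)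
  define P where "P y t = x0 + integral {0..cl t} (\<lambda>s. F (apply_bcontfun y s))" for y t
  have contFy: "continuous_on S (\<lambda>s. F (apply_bcontfun y s))" for y S
    by (rule continuous_on_compose2[OF contF]) auto
  have inty: "(\<lambda>s. F (apply_bcontfun y s)) integrable_on {0..t}" for y and t :: real
    by (intro integrable_continuous_interval contFy)
  have "P y \<in> bcontfun" for y
    unfolding bcontfun_def
  proof (intro CollectI conjI)
    have "continuous_on {0..\<eta>} (\<lambda>t. x0 + integral {0..t} (\<lambda>s. F (apply_bcontfun y s)))"
      by (intro continuous_intros indefinite_integral_continuous_1 inty)
    moreover have "continuous_on UNIV cl" unfolding cl_def by (intro continuous_intros)
    ultimately show "continuous_on UNIV (P y)"
      unfolding P_def using continuous_on_compose2[of "{0..\<eta>}" _ UNIV cl] cl(1) by blast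
    show "bounded (range (P y))"
    proof (rule boundedI)
      fix w assume "w \<in> range (P y)"
      then obtain t where w: "w = P y t" by auto
      have "norm (integral {0..cl t} (\<lambda>s. F (apply_bcontfun y s))) \<le> B * (cl t - 0)"
        by (rule integral_bound) (use cl[of t] bd contFy in auto)
      also have "\<dots> \<le> B * \<eta>"
        using cl[of t] order_trans[OF norm_ge_zero bd] by (auto intro: mult_left_mono)
      finally show "norm w \<le> norm x0 + B * \<eta>"
        unfolding w P_def using norm_triangle_ineq[of x0] by (smt (verit))
    qed
  qed
  then have app: "apply_bcontfun (Bcontfun (P y)) = P y" for y by (simp add: Bcontfun_inverse)
  have "\<exists>!y. Bcontfun (P y) = y"
  proof (rule banach_fix_type[of "K * \<eta>"])
    show "0 \<le> K * \<eta>" "K * \<eta> < 1" using assms by auto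
    show "\<forall>y z. dist (Bcontfun (P y)) (Bcontfun (P z)) \<le> K * \<eta> * dist y z"
    proof (intro allI dist_bound)
      fix y z t
      have "P y t - P z t = integral {0..cl t} (\<lambda>s. F (apply_bcontfun y s) - F (apply_bcontfun z s))"
        unfolding P_def using integral_diff[OF inty inty] by simp
      also have "norm \<dots> \<le> K * dist y z * (cl t - 0)"
      proof (rule integral_bound)
        fix s
        have "norm (F (apply_bcontfun y s) - F (apply_bcontfun z s)) \<le> K * dist (apply_bcontfun y s) (apply_bcontfun z s)"
          using lip by (simp add: dist_norm)
        also have "\<dots> \<le> K * dist y z" using dist_bounded assms by (auto intro: mult_left_mono)
        finally show "norm (F (apply_bcontfun y s) - F (apply_bcontfun z s)) \<le> K * dist y z" .
      qed (use cl[of t] in \<open>auto intro: continuous_on_diff contFy\<close>)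
      also have "\<dots> \<le> K * dist y z * \<eta>" using cl[of t] assms by (intro mult_left_mono) auto
      finally show "dist (apply_bcontfun (Bcontfun (P y)) t) (apply_bcontfun (Bcontfun (P z)) t) \<le> K * \<eta> * dist y z"
        unfolding app by (simp add: dist_norm mult_ac)
    qed
  qed
  then obtain y where y: "Bcontfun (P y) = y" by blast
  define z where "z = apply_bcontfun y"
  have zP: "z = P y" using app[of y] y by (simp add: z_def)
  have z: "z t = x0 + integral {0..t} (\<lambda>s. F (z s))" if "t \<in> {0..\<eta>}" for t
    using fun_cong[OF zP, of t] cl(2)[OF that] by (simp add: P_def z_def)
  have zc: "continuous_on S (\<lambda>s. F (z s))" for S unfolding z_def by (rule contFy)
  show ?thesis
  proof (intro exI[of _ z] conjI ballI)
    show "z 0 = x0" using z[of 0] assms by simp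
    fix t assume t: "t \<in> {0..\<eta>}"
    have "norm (integral {0..t} (\<lambda>s. F (z s))) \<le> B * (t - 0)"
      by (rule integral_bound) (use t bd zc in auto)
    then show "norm (z t - x0) \<le> B * t" using z[OF t] by simp
    have "((\<lambda>t. x0 + integral {0..t} (\<lambda>s. F (z s))) has_vector_derivative 0 + F (z t)) (at t within {0..\<eta>})"
      by (intro has_vector_derivative_add has_vector_derivative_const
          integral_has_vector_derivative zc t)
    then have "((\<lambda>t. x0 + integral {0..t} (\<lambda>s. F (z s))) has_vector_derivative F (z t)) (at t within {0..\<eta>})"
      by simp
    then show "(z has_vector_derivative F (z t)) (at t within {0..\<eta>})"
      by (rule has_vector_derivative_transform[OF t, rotated]) (use z in simp)
  qed
qed

text \<open>A cut-off field that agrees with \<open>f\<close> on a ball is solved globally; for a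
  short time the solution does not leave the ball, so the cut-off is not noticed.\<close>

lemma picard_backward:
  fixes f :: "real^'d::finite \<Rightarrow> real^'d"
  assumes f: "smooth_on S f" and S: "open S" "x0 \<in> S"
  shows "\<exists>\<eta>>0. \<exists>y. y 0 = x0 \<and> (\<forall>t\<in>{-\<eta>..0}. y t \<in> S \<and> (y has_vector_derivative f (y t)) (at t within {-\<eta>..0}))"
proof -
  obtain r where r: "r > 0" "cball x0 r \<subseteq> S" using S open_contains_cball by blast
  obtain K where K: "K \<ge> 0" "\<And>y z. y \<in> cball x0 r \<Longrightarrow> z \<in> cball x0 r \<Longrightarrow> norm (f y - f z) \<le> K * norm (y - z)"
    using smooth_on_lipschitz_cball[OF f S(1) r(2)] by blast
  have "bounded (f ` cball x0 r)"
    using smooth_on_imp_continuous_on[OF f] r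
    by (intro compact_imp_bounded compact_continuous_image compact_cball) (auto intro: continuous_on_subset)
  then obtain B where B: "B > 0" "\<And>y. y \<in> cball x0 r \<Longrightarrow> norm (f y) \<le> B" unfolding bounded_pos by blast
  \<comment> \<open>Projection to the nearest point of the ball does not increase distances, so it
    extends \<open>f\<close> to a bounded Lipschitz field on all of space. The minus sign reverses
    time.\<close>
  define F where "F x = - f (closest_point (cball x0 r) x)" for x
  have ne: "cball x0 r \<noteq> {}" using r by simp
  have cp: "closest_point (cball x0 r) x \<in> cball x0 r" for x
    using closest_point_in_set[OF closed_cball ne] .
  \<comment> \<open>The first entry keeps the solution within distance \<open>r\<close> of
    \<open>x0\<close>, the second makes the Picard operator a contraction.\<close>
  define \<eta> where "\<eta> = min (r / B) (1 / (2 * (K + 1)))"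
  have eta: "\<eta> > 0" "B * \<eta> \<le> r" "K * \<eta> < 1"
  proof -
    show "\<eta> > 0" using r B K by (simp add: \<eta>_def)
    have "\<eta> \<le> r / B" by (simp add: \<eta>_def)
    then show "B * \<eta> \<le> r" using B by (simp add: field_simps)
    have "\<eta> \<le> 1 / (2 * (K + 1))" by (simp add: \<eta>_def)
    then have "K * \<eta> \<le> K * (1 / (2 * (K + 1)))" using K(1) by (rule mult_left_mono)
    also have "\<dots> < 1" using K(1) by (simp add: field_simps)
    finally show "K * \<eta> < 1" .
  qed
  have "\<exists>z. z 0 = x0 \<and> (\<forall>t\<in>{0..\<eta>}. norm (z t - x0) \<le> B * t \<and>
    (z has_vector_derivative F (z t)) (at t within {0..\<eta>}))"
  proof (rule picard_global[OF _ _ K(1) eta(1,3)])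
    fix x y
    have "norm (F x - F y) \<le> K * dist (closest_point (cball x0 r) x) (closest_point (cball x0 r) y)"
      using K(2)[OF cp cp, of y x] by (simp add: F_def dist_norm norm_minus_commute)
    also have "\<dots> \<le> K * norm (x - y)"
      using closest_point_lipschitz[OF convex_cball closed_cball ne, of x y] K(1)
      by (auto simp: dist_norm intro: mult_left_mono)
    finally show "norm (F x - F y) \<le> K * norm (x - y)" .
    show "norm (F x) \<le> B" using B(2)[OF cp] by (simp add: F_def)
  qed
  then obtain z where z: "z 0 = x0" "\<And>t. t \<in> {0..\<eta>} \<Longrightarrow> norm (z t - x0) \<le> B * t"
    "\<And>t. t \<in> {0..\<eta>} \<Longrightarrow> (z has_vector_derivative F (z t)) (at t within {0..\<eta>})" by blast
  have zin: "z t \<in> cball x0 r" if "t \<in> {0..\<eta>}" for t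
  proof -
    have "B * t \<le> B * \<eta>" using that B by (intro mult_left_mono) auto
    then show ?thesis using z(2)[OF that] eta(2) by (simp add: dist_norm norm_minus_commute)
  qed
  define y where "y = z \<circ> uminus"
  have "(y has_vector_derivative f (y t)) (at t within {-\<eta>..0})" if t: "t \<in> {-\<eta>..0}" for t
  proof -
    have t': "- t \<in> {0..\<eta>}" using t by auto
    have "(uminus has_vector_derivative -1) (at t within {-\<eta>..0})"
      by (auto intro!: derivative_eq_intros)
    moreover have "(z has_vector_derivative F (z (- t))) (at (- t) within uminus ` {-\<eta>..0})"
      using z(3)[OF t'] by simp
    ultimately have "(z \<circ> uminus has_vector_derivative (-1) *\<^sub>R F (z (- t))) (at t within {-\<eta>..0})"
      by (rule vector_diff_chain_within)
    moreover have "F (z (- t)) = - f (z (- t))"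
      unfolding F_def using closest_point_self[OF zin[OF t']] by simp
    ultimately show ?thesis by (simp add: y_def)
  qed
  moreover have "y t \<in> S" if "t \<in> {-\<eta>..0}" for t
    using zin[of "- t"] that r by (auto simp: y_def)
  moreover have "y 0 = x0" by (simp add: y_def z)
  ultimately show ?thesis using eta by blast
qed

section \<open>Integral curves on the manifold and their extension to the past\<close>

lemma exists_past_integral_curve:
  assumes mf: "smooth_manifold X A" and u: "vector_field A u" "smooth_components A u" and q: "q \<in> X"
  shows "\<exists>\<eta>>0. \<exists>\<gamma>. integral_curve A u {-\<eta>..0} \<gamma> \<and> \<gamma> 0 = q"
proof -
  note D = smooth_manifoldD[OF mf]
  obtain c where c: "c \<in> A" "q \<in> fst c" using D(3) q by blast
  have ch: "is_chart c" using D c by auto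
  have sm: "smooth_on (snd c ` fst c) (u c \<circ> chart_inv c)"
    using u(2) c by (simp add: smooth_components_def)
  obtain \<eta> y where y: "\<eta> > 0" "y 0 = snd c q"
    "\<And>t. t \<in> {-\<eta>..0} \<Longrightarrow> y t \<in> snd c ` fst c"
    "\<And>t. t \<in> {-\<eta>..0} \<Longrightarrow> (y has_vector_derivative (u c \<circ> chart_inv c) (y t)) (at t within {-\<eta>..0})"
    using picard_backward[OF sm, of "snd c q"] ch c by (auto simp: is_chart_def)
  define \<gamma> where "\<gamma> t = chart_inv c (y t)" for t
  have sg: "snd c (\<gamma> t) = y t" "\<gamma> t \<in> fst c" if "t \<in> {-\<eta>..0}" for t
    using chart_inv_right[OF ch] chart_inv_in[OF ch] y(3)[OF that] by (auto simp: \<gamma>_def)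
  have "continuous_on {-\<eta>..0} y"
    using y(4) has_vector_derivative_continuous continuous_on_eq_continuous_within by blast
  then have cont: "continuous_on {-\<eta>..0} \<gamma>"
    unfolding \<gamma>_def using continuous_on_compose2[OF continuous_on_chart_inv[OF ch]] y(3) by blast
  have "((snd d \<circ> \<gamma>) has_vector_derivative u d (\<gamma> t)) (at t within {-\<eta>..0})"
    if t: "t \<in> {-\<eta>..0}" and d: "d \<in> A" "\<gamma> t \<in> fst d" for t d
  proof -
    have "((snd c \<circ> \<gamma>) has_vector_derivative u c (\<gamma> t)) (at t within {-\<eta>..0})"
      using has_vector_derivative_transform[OF t _ y(4)[OF t], of "snd c \<circ> \<gamma>"] sg(1)
      by (simp add: \<gamma>_def)
    then have "((snd d \<circ> \<gamma>) has_vector_derivative (trans_jac c d (\<gamma> t) *v u c (\<gamma> t))) (at t within {-\<eta>..0})"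
      using curve_change_chart[where \<gamma> = \<gamma>, OF ch D(1)[OF d(1)] D(2)[OF c(1) d(1)] _ t d(2)] sg by blast
    moreover have "u d (\<gamma> t) = trans_jac c d (\<gamma> t) *v u c (\<gamma> t)"
      using u(1)[unfolded vector_field_def, rule_format, OF c(1) d(1) IntI[OF sg(2)[OF t] d(2)]] .
    ultimately show ?thesis by simp
  qed
  moreover have "interior {-\<eta>..0} \<noteq> {}" using y(1) by simp
  moreover have "\<gamma> ` {-\<eta>..0} \<subseteq> (\<Union>c\<in>A. fst c)" using sg(2) c by blast
  ultimately have "integral_curve A u {-\<eta>..0} \<gamma>"
    using cont is_interval_cc unfolding integral_curve_def by blast
  moreover have "\<gamma> 0 = q" using y(2) chart_inv_left[OF ch c(2)] by (simp add: \<gamma>_def)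
  ultimately show ?thesis using y(1) by blast
qed

lemma integral_curve_subset:
  assumes "integral_curve A u I \<gamma>" "J \<subseteq> I" "is_interval J" "interior J \<noteq> {}"
  shows "integral_curve A u J \<gamma>"
  unfolding integral_curve_def
proof (intro conjI ballI impI)
  show "continuous_on J \<gamma>" "\<gamma> ` J \<subseteq> (\<Union>c\<in>A. fst c)"
    using assms unfolding integral_curve_def by (auto intro: continuous_on_subset)
  fix t c assume "t \<in> J" "c \<in> A" "\<gamma> t \<in> fst c"
  then show "((snd c \<circ> \<gamma>) has_vector_derivative u c (\<gamma> t)) (at t within J)"
    using assms unfolding integral_curve_def
    by (meson has_vector_derivative_within_subset subsetD)
qed (use assms in auto)

text \<open>Each \<open>J\<close> contains a neighbourhood of \<open>t\<close> relative to
  \<open>I\<close>, so limits and derivatives at \<open>t\<close> within \<open>I\<close> and within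
  \<open>J\<close> coincide. This serves for the union of a chain of curves.\<close>

lemma integral_curve_locally:
  assumes I: "is_interval I" "interior I \<noteq> {}"
    and loc: "\<And>t. t \<in> I \<Longrightarrow> \<exists>J \<delta> W. integral_curve A u J \<delta> \<and> J \<subseteq> I \<and> open W \<and> t \<in> W \<and> I \<inter> W \<subseteq> J \<and> (\<forall>s\<in>J. \<gamma> s = \<delta> s)"
  shows "integral_curve A u I \<gamma>"
proof -
  have *: "\<exists>J \<delta>. integral_curve A u J \<delta> \<and> t \<in> J \<and> at t within I = at t within J \<and> (\<forall>s\<in>J. \<gamma> s = \<delta> s)" if t: "t \<in> I" for t
  proof -
    obtain J \<delta> W where J: "integral_curve A u J \<delta>" "J \<subseteq> I" "open W" "t \<in> W" "I \<inter> W \<subseteq> J" "\<forall>s\<in>J. \<gamma> s = \<delta> s"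
      using loc[OF t] by blast
    have "at t within I = at t within J"
      by (rule at_within_nhd[OF J(4,3)]) (use J in auto)
    then show ?thesis using J t by blast
  qed
  show ?thesis unfolding integral_curve_def
  proof (intro conjI ballI impI)
    show "\<gamma> ` I \<subseteq> (\<Union>c\<in>A. fst c)"
    proof (rule image_subsetI)
      fix t assume "t \<in> I"
      from *[OF this] obtain J \<delta> where "\<delta> ` J \<subseteq> (\<Union>c\<in>A. fst c)" "t \<in> J" "\<forall>s\<in>J. \<gamma> s = \<delta> s"
        unfolding integral_curve_def by blast
      then show "\<gamma> t \<in> (\<Union>c\<in>A. fst c)" by (simp add: image_subset_iff)
    qed
    show "continuous_on I \<gamma>"
      unfolding continuous_on_def
    proof
      fix t assume "t \<in> I"
      from *[OF this] obtain J \<delta> where J: "integral_curve A u J \<delta>" "t \<in> J"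
        "at t within I = at t within J" "\<forall>s\<in>J. \<gamma> s = \<delta> s" by blast
      have "(\<delta> \<longlongrightarrow> \<delta> t) (at t within J)"
        using J unfolding integral_curve_def continuous_on_def by blast
      moreover have "\<forall>\<^sub>F s in at t within J. \<delta> s = \<gamma> s"
        using J(4) by (simp add: eventually_at_filter)
      ultimately show "(\<gamma> \<longlongrightarrow> \<gamma> t) (at t within I)"
        using J tendsto_cong by force
    qed
    fix t c assume t: "t \<in> I" and c: "c \<in> A" "\<gamma> t \<in> fst c"
    from *[OF t] obtain J \<delta> where J: "integral_curve A u J \<delta>" "t \<in> J"
      "at t within I = at t within J" "\<forall>s\<in>J. \<gamma> s = \<delta> s" by blast
    have "((snd c \<circ> \<delta>) has_vector_derivative u c (\<delta> t)) (at t within J)"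
      using J c unfolding integral_curve_def by auto
    then have "((snd c \<circ> \<gamma>) has_vector_derivative u c (\<gamma> t)) (at t within J)"
      using has_vector_derivative_transform[OF J(2), of "snd c \<circ> \<gamma>" "snd c \<circ> \<delta>"] J(2,4) by simp
    then show "((snd c \<circ> \<gamma>) has_vector_derivative u c (\<gamma> t)) (at t within I)" using J(3) by simp
  qed (use I in auto)
qed

text \<open>Zorn's lemma on the graphs avoids proving uniqueness of integral curves.\<close>

lemma exists_past_maximal_integral_curve:
  assumes mf: "smooth_manifold X A" and u: "vector_field A u" "smooth_components A u" and q: "q \<in> X"
  shows "\<exists>I \<gamma>. past_maximal_integral_curve A u I \<gamma> \<and> 0 \<in> I \<and> I \<subseteq> {..0} \<and> \<gamma> 0 = q"
proof -
  \<comment> \<open>Values of a curve outside its domain are arbitrary; the graph over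
    \<open>I\<close> forgets them, so that inclusion of graphs is exactly extension of
    curves.\<close>
  define gr where "gr I \<gamma> = (\<lambda>t. (t, \<gamma> t)) ` I" for I :: "real set" and \<gamma> :: "real \<Rightarrow> 'a"
  \<comment> \<open>All domains end at parameter 0, so members of a chain differ only towards the
    past.\<close>
  define P where "P I \<gamma> \<longleftrightarrow> integral_curve A u I \<gamma> \<and> 0 \<in> I \<and> I \<subseteq> {..0} \<and> \<gamma> 0 = q" for I \<gamma>
  define Z where "Z = {gr I \<gamma> | I \<gamma>. P I \<gamma>}"
  obtain \<eta> \<gamma>0 where "\<eta> > 0" "integral_curve A u {-\<eta>..0} \<gamma>0" "\<gamma>0 0 = q"
    using exists_past_integral_curve[OF assms] by blast
  then have "P {-\<eta>..0} \<gamma>0" by (simp add: P_def)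
  then have "Z \<noteq> {}" by (auto simp: Z_def)
  moreover have "\<Union>C \<in> Z" if C: "C \<noteq> {}" "subset.chain Z C" for C
  proof -
    have CZ: "C \<subseteq> Z" and lin: "\<And>G H. G \<in> C \<Longrightarrow> H \<in> C \<Longrightarrow> G \<subseteq> H \<or> H \<subseteq> G"
      using C(2) by (auto simp: subset_chain_def)
    define I where "I = fst ` \<Union>C"
    define \<gamma> where "\<gamma> t = (SOME y. (t, y) \<in> \<Union>C)" for t
    have uniq: "y = y'" if ty: "(t, y) \<in> \<Union>C" "(t, y') \<in> \<Union>C" for t y y'
    proof -
      obtain G H where GH: "G \<in> C" "H \<in> C" "(t, y) \<in> G" "(t, y') \<in> H" using ty by blast
      then obtain K where "K \<in> C" "(t, y) \<in> K" "(t, y') \<in> K" using lin by blast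
      then show ?thesis using CZ by (auto simp: Z_def gr_def)
    qed
    have \<gamma>: "\<gamma> t = y" if "(t, y) \<in> \<Union>C" for t y
      using uniq[OF _ that] someI[of "\<lambda>y. (t, y) \<in> \<Union>C", OF that] unfolding \<gamma>_def by blast
    have gr: "\<Union>C = gr I \<gamma>"
      unfolding gr_def I_def using \<gamma> by force
    have mem: "\<exists>J \<delta>. P J \<delta> \<and> t \<in> J \<and> J \<subseteq> I \<and> gr J \<delta> \<in> C \<and> (\<forall>s\<in>J. \<gamma> s = \<delta> s)" if t: "t \<in> I" for t
    proof -
      obtain G y where G: "G \<in> C" "(t, y) \<in> G" using t by (auto simp: I_def)
      then obtain J \<delta> where J: "G = gr J \<delta>" "P J \<delta>" using CZ by (auto simp: Z_def)
      have "t \<in> J" using G J by (auto simp: gr_def)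
      moreover have "s \<in> I \<and> \<gamma> s = \<delta> s" if "s \<in> J" for s
      proof -
        have "(s, \<delta> s) \<in> \<Union>C" using that G(1) J(1) by (auto simp: gr_def)
        then show ?thesis using \<gamma> by (force simp: I_def)
      qed
      ultimately show ?thesis using J G(1) by blast
    qed
    have I0: "I \<subseteq> {..0}"
    proof
      fix t assume "t \<in> I"
      from mem[OF this] obtain J \<delta> where "P J \<delta>" "t \<in> J" by blast
      then show "t \<in> {..0}" unfolding P_def by blast
    qed
    have Ine: "I \<noteq> {}"
    proof -
      obtain G where "G \<in> C" using C(1) by blast
      moreover then obtain J \<delta> where "G = gr J \<delta>" "P J \<delta>" using CZ by (auto simp: Z_def)
      ultimately have "(0, \<delta> 0) \<in> \<Union>C" by (auto simp: P_def gr_def)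
      then show ?thesis by (force simp: I_def)
    qed
    then obtain t0 where "t0 \<in> I" by blast
    from mem[OF this] obtain J0 \<delta>0 where J0: "P J0 \<delta>0" "J0 \<subseteq> I" "\<forall>s\<in>J0. \<gamma> s = \<delta>0 s" by blast
    have "is_interval I"
      unfolding is_interval_1
    proof (intro ballI allI impI)
      fix a b x assume ab: "a \<in> I" "b \<in> I" and x: "a \<le> x \<and> x \<le> b"
      from mem[OF ab(1)] obtain J \<delta> where J: "P J \<delta>" "a \<in> J" "J \<subseteq> I" by blast
      have "b \<le> 0" using I0 ab(2) by auto
      then have "a \<le> x \<and> x \<le> 0" using x by simp
      moreover have "is_interval J" "0 \<in> J" using J(1) unfolding P_def integral_curve_def by blast+
      ultimately show "x \<in> I" using J(2,3) unfolding is_interval_1 by blast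
    qed
    moreover have "interior I \<noteq> {}"
      using interior_mono[OF J0(2)] J0(1) by (auto simp: P_def integral_curve_def)
    ultimately have "integral_curve A u I \<gamma>"
    proof (rule integral_curve_locally)
      fix t assume t: "t \<in> I"
      \<comment> \<open>If some \<open>s\<close> in \<open>I\<close> lies before \<open>t\<close>, a
        member of the chain defined at \<open>s\<close> covers all of \<open>I\<close> after
        \<open>s\<close>. Otherwise \<open>t\<close> is the least element of \<open>I\<close>, and a
        member defined at \<open>t\<close> covers \<open>I\<close> entirely.\<close>
      obtain J \<delta> W where J: "P J \<delta>" "J \<subseteq> I" "\<forall>s\<in>J. \<gamma> s = \<delta> s" and W: "open W" "t \<in> W" "I \<inter> W \<subseteq> J"
      proof (cases "\<exists>s\<in>I. s < t")
        case True
        then obtain s where s: "s \<in> I" "s < t" by blast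
        from mem[OF s(1)] obtain J \<delta> where J: "P J \<delta>" "s \<in> J" "J \<subseteq> I" "\<forall>s\<in>J. \<gamma> s = \<delta> s" by blast
        have "x \<in> J" if "x \<in> I \<inter> {s<..}" for x
        proof -
          have "s \<le> x \<and> x \<le> 0" using I0 that by auto
          moreover have "is_interval J" "0 \<in> J" using J(1) unfolding P_def integral_curve_def by blast+
          ultimately show ?thesis using J(2) unfolding is_interval_1 by blast
        qed
        then have "I \<inter> {s<..} \<subseteq> J" by blast
        moreover have "open {s<..}" "t \<in> {s<..}" using s by auto
        ultimately show ?thesis using that[OF J(1,3,4)] by blast
      next
        case False
        from mem[OF t] obtain J \<delta> where J: "P J \<delta>" "t \<in> J" "J \<subseteq> I" "\<forall>s\<in>J. \<gamma> s = \<delta> s" by blast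
        have "x \<in> J" if "x \<in> I" for x
        proof -
          have "t \<le> x \<and> x \<le> 0" using I0 that False by auto
          moreover have "is_interval J" "0 \<in> J" using J(1) unfolding P_def integral_curve_def by blast+
          ultimately show ?thesis using J(2) unfolding is_interval_1 by blast
        qed
        then have "I \<inter> UNIV \<subseteq> J" by blast
        then show ?thesis using that[OF J(1,3,4) open_UNIV] by blast
      qed
      then show "\<exists>J \<delta> W. integral_curve A u J \<delta> \<and> J \<subseteq> I \<and> open W \<and> t \<in> W \<and> I \<inter> W \<subseteq> J \<and> (\<forall>s\<in>J. \<gamma> s = \<delta> s)"
        unfolding P_def by blast
    qed
    moreover have "0 \<in> J0" "\<delta>0 0 = q" using J0(1) unfolding P_def by blast+
    then have "0 \<in> I" "\<gamma> 0 = q" using J0(2,3) by auto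
    moreover note I0
    ultimately have "P I \<gamma>" unfolding P_def by blast
    then show ?thesis unfolding gr Z_def by blast
  qed
  ultimately obtain G where G: "G \<in> Z" "\<And>H. H \<in> Z \<Longrightarrow> G \<subseteq> H \<Longrightarrow> H = G"
    using subset_Zorn_nonempty[of Z] by blast
  then obtain I \<gamma> where I: "G = gr I \<gamma>" "P I \<gamma>" by (auto simp: Z_def)
  have "past_maximal_integral_curve A u I \<gamma>"
    unfolding past_maximal_integral_curve_def
  proof (intro conjI notI)
    show "integral_curve A u I \<gamma>" using I by (simp add: P_def)
    assume "\<exists>I' \<gamma>'. integral_curve A u I' \<gamma>' \<and> I \<subseteq> I' \<and> (\<forall>t\<in>I. \<gamma>' t = \<gamma> t) \<and> (\<exists>s\<in>I'. \<forall>t\<in>I. s < t)"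
    then obtain I' \<gamma>' s where I': "integral_curve A u I' \<gamma>'" "I \<subseteq> I'" "\<forall>t\<in>I. \<gamma>' t = \<gamma> t"
      and s: "s \<in> I'" "\<forall>t\<in>I. s < t" by blast
    \<comment> \<open>The competing extension may also run into the future of 0; cutting it there
      makes it an element of \<open>Z\<close>.\<close>
    let ?J = "I' \<inter> {..0}"
    have sub: "I \<subseteq> ?J" using I I' by (auto simp: P_def)
    have "integral_curve A u ?J \<gamma>'"
    proof (rule integral_curve_subset[OF I'(1)])
      show "is_interval ?J" using I'(1) by (intro is_interval_Int is_interval_ic) (simp add: integral_curve_def)
      show "interior ?J \<noteq> {}" using interior_mono[OF sub] I by (auto simp: P_def integral_curve_def)
    qed auto
    then have "P ?J \<gamma>'" using I I' by (auto simp: P_def)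
    then have "gr ?J \<gamma>' \<in> Z" by (auto simp: Z_def)
    moreover have "G \<subseteq> gr ?J \<gamma>'" using sub I' I by (force simp: gr_def)
    ultimately have "gr ?J \<gamma>' = gr I \<gamma>" using G(2) I by blast
    moreover have "s \<in> ?J" using s I by (force simp: P_def)
    ultimately have "s \<in> I" by (force simp: gr_def)
    then show False using s by blast
  qed
  then show ?thesis using I by (auto simp: P_def)
qed

subsection \<open>The trace of the Einstein equations\<close>

text \<open>The trace of the metric is the dimension, and the trace of the squared covector of
  \<open>v\<close> is \<open>bilin G v v\<close>, that is, -1.\<close>

lemma perfect_fluid_trace:
  fixes G :: "real^'d::finite^'d" and v :: "real^'d"
  assumes G: "lorentzian_form G" and v: "bilin G v v = -1"
    and E: "\<And>i j. E $ i $ j = 1/2 * R * G $ i $ j + 8 * pi * ((\<rho> + p) * ((v v* G) $ i * (v v* G) $ j) + p * G $ i $ j)"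
  shows "(\<Sum>i\<in>UNIV. \<Sum>j\<in>UNIV. matrix_inv G $ i $ j * E $ i $ j) =
    (1/2 * R + 8 * pi * p) * real CARD('d) - 8 * pi * (\<rho> + p)"
proof -
  let ?H = "matrix_inv G"
  have sym: "transpose G = G" using G by (simp add: lorentzian_form_def)
  have "invertible G" using lorentzian_form_det[OF G] by (simp add: invertible_det_nz)
  then have H: "?H ** G = mat 1"
    unfolding invertible_def matrix_inv_def by (rule someI2_ex) auto
  have Gij: "G $ i $ j = G $ j $ i" for i j using sym by (metis transpose_def vec_lambda_beta)
  have 1: "(\<Sum>i\<in>UNIV. \<Sum>j\<in>UNIV. ?H $ i $ j * G $ i $ j) = real CARD('d)"
  proof -
    have "(\<Sum>j\<in>UNIV. ?H $ i $ j * G $ i $ j) = 1" for i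
    proof -
      have "(\<Sum>j\<in>UNIV. ?H $ i $ j * G $ j $ i) = (?H ** G) $ i $ i"
        by (simp add: matrix_matrix_mult_def)
      then show ?thesis unfolding H by (simp add: mat_def Gij[of i])
    qed
    then show ?thesis by simp
  qed
  have low: "v v* G = G *v v" using sym by (metis transpose_matrix_vector)
  have "(\<Sum>i\<in>UNIV. \<Sum>j\<in>UNIV. ?H $ i $ j * ((v v* G) $ i * (v v* G) $ j)) = bilin ?H (G *v v) (G *v v)"
    unfolding low bilin_def by (simp add: mult_ac)
  also have "\<dots> = bilin G v v"
    unfolding bilin_inner by (simp add: matrix_vector_mul_assoc H inner_commute)
  finally have 2: "(\<Sum>i\<in>UNIV. \<Sum>j\<in>UNIV. ?H $ i $ j * ((v v* G) $ i * (v v* G) $ j)) = -1"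
    using v by simp
  have "?H $ i $ j * E $ i $ j = (1/2 * R + 8 * pi * p) * (?H $ i $ j * G $ i $ j)
      + 8 * pi * (\<rho> + p) * (?H $ i $ j * ((v v* G) $ i * (v v* G) $ j))" for i j
    unfolding E by (simp add: algebra_simps)
  then show ?thesis
    by (simp add: sum.distrib 1 2 flip: sum_distrib_left)
qed

text \<open>The traced equation has the scalar curvature on both sides, with coefficients 1 and
  \<open>(n + 1) / 2\<close>; collecting them leaves the factor \<open>n - 1\<close>, which is
  nonzero for \<open>n \<ge> 2\<close>.\<close>

lemma scalar_curvature_perfect_fluid:
  fixes A :: "('a::{t2_space, second_countable_topology}, 'd::finite) chart set"
  assumes ein: "einstein_perfect_fluid A g u \<rho> p" and fl: "perfect_fluid A g T u \<rho> p"
    and g: "lorentzian_metric A g" and q: "q \<in> (\<Union>c\<in>A. fst c)" and n: "CARD('d) = n + 1" "n \<ge> 2"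
  shows "scalar_curvature A g q = 16 * pi / (real n - 1) * (\<rho> q - real n * p q)"
proof -
  define c where "c = (SOME c. c \<in> A \<and> q \<in> fst c)"
  have c: "c \<in> A \<and> q \<in> fst c" unfolding c_def by (rule someI_ex) (use q in auto)
  let ?R = "scalar_curvature A g q"
  have "?R = (\<Sum>i\<in>UNIV. \<Sum>j\<in>UNIV. matrix_inv (g c q) $ i $ j * ricci g c q $ i $ j)"
    unfolding scalar_curvature_def c_def[symmetric] by (simp add: Let_def)
  also have "\<dots> = (1/2 * ?R + 8 * pi * p q) * real CARD('d) - 8 * pi * (\<rho> q + p q)"
  proof (rule perfect_fluid_trace[where v = "u c q"])
    show "lorentzian_form (g c q)" using g c by (simp add: lorentzian_metric_def)
    show "bilin (g c q) (u c q) (u c q) = -1" using fl c by (simp add: perfect_fluid_def)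
    fix i j
    have "ricci g c q $ i $ j - 1/2 * ?R * g c q $ i $ j =
        8 * pi * ((\<rho> q + p q) * (lower_index g u c q $ i * lower_index g u c q $ j) + p q * g c q $ i $ j)"
      using ein c unfolding einstein_perfect_fluid_def by blast
    then show "ricci g c q $ i $ j = 1/2 * ?R * g c q $ i $ j + 8 * pi * ((\<rho> q + p q) *
       ((u c q v* g c q) $ i * (u c q v* g c q) $ j) + p q * g c q $ i $ j)"
      unfolding lower_index_def by linarith
  qed
  finally have "?R * (real n - 1) = 16 * pi * (\<rho> q - real n * p q)"
    unfolding n(1) by (simp add: field_simps)
  then show ?thesis using n(2) by (simp add: field_simps)
qed

subsection \<open>Convergence of the fluid velocity\<close>

text \<open>The products of the components determine the covector only up to sign; the sign is fixed by
  the time orientation, as the reverse Cauchy--Schwarz inequality keeps \<open>g(T, u)\<close> away from zero.\<close>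

lemma fluid_velocity_tendsto:
  fixes G :: "'x \<Rightarrow> real^'d::finite^'d" and v t :: "'x \<Rightarrow> real^'d" and L :: "'d \<Rightarrow> 'd \<Rightarrow> real"
  assumes F: "F \<noteq> bot" and G: "(G \<longlongrightarrow> G0) F" and t: "(t \<longlongrightarrow> t0) F"
    and G0: "lorentzian_form G0" "bilin G0 t0 t0 < 0"
    and ev: "\<forall>\<^sub>F q in F. lorentzian_form (G q) \<and> bilin (G q) (v q) (v q) = -1 \<and> bilin (G q) (t q) (v q) < 0
       \<and> bilin (G q) (t q) (t q) < 0"
    and L: "\<And>i j. ((\<lambda>q. (G q *v v q) $ i * (G q *v v q) $ j) \<longlongrightarrow> L i j) F"
  shows "\<exists>v0. (v \<longlongrightarrow> v0) F \<and> bilin G0 v0 v0 = -1 \<and> bilin G0 t0 v0 < 0"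
proof -
  define l where "l q = G q *v v q" for q
  define \<phi> where "\<phi> q = bilin (G q) (t q) (v q)" for q
  have \<phi>: "\<phi> q = (\<Sum>i\<in>UNIV. t q $ i * l q $ i)" for q
    by (simp add: \<phi>_def l_def bilin_inner inner_vec_def)
  \<comment> \<open>\<open>m\<close> will be the limit of the square of \<phi>, which is a
    polynomial in \<open>t\<close> and the products of covector components, the only data known to
    converge so far.\<close>
  define m where "m = (\<Sum>i\<in>UNIV. \<Sum>j\<in>UNIV. t0 $ i * t0 $ j * L i j)"
  have sq: "(\<phi> q)\<^sup>2 = (\<Sum>i\<in>UNIV. \<Sum>j\<in>UNIV. t q $ i * t q $ j * (l q $ i * l q $ j))" for q
    unfolding \<phi> power2_eq_square sum_product by (simp add: mult_ac)
  have lim_sq: "((\<lambda>q. (\<phi> q)\<^sup>2) \<longlongrightarrow> m) F"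
    unfolding sq m_def l_def by (intro tendsto_intros t L)
  have "((\<lambda>q. - bilin (G q) (t q) (t q)) \<longlongrightarrow> - bilin G0 t0 t0) F"
    by (intro tendsto_intros G t)
  moreover have "\<forall>\<^sub>F q in F. - bilin (G q) (t q) (t q) \<le> (\<phi> q)\<^sup>2"
    using ev
  proof eventually_elim
    case (elim q)
    then have "bilin (G q) (t q) (t q) * bilin (G q) (v q) (v q) \<le> (\<phi> q)\<^sup>2"
      unfolding \<phi>_def by (intro reverse_Cauchy_Schwarz) auto
    with elim show ?case by simp
  qed
  ultimately have "- bilin G0 t0 t0 \<le> m" by (rule tendsto_le[OF F lim_sq])
  then have m: "m > 0" using G0(2) by linarith
  have "((\<lambda>q. - sqrt ((\<phi> q)\<^sup>2)) \<longlongrightarrow> - sqrt m) F" by (intro tendsto_intros lim_sq)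
  moreover have "\<forall>\<^sub>F q in F. - sqrt ((\<phi> q)\<^sup>2) = \<phi> q"
    using ev by eventually_elim (simp add: \<phi>_def)
  ultimately have lim_\<phi>: "(\<phi> \<longlongrightarrow> - sqrt m) F" using tendsto_cong by force
  \<comment> \<open>Contracting the products with \<open>t\<close> in one index gives
    \<open>\<phi> q * l q $ j\<close>, and \<phi> has a nonzero limit; the quotient recovers the
    covector itself.\<close>
  define l0 where "l0 = (\<chi> j. (\<Sum>i\<in>UNIV. t0 $ i * L i j) / - sqrt m)"
  have "((\<lambda>q. l q $ j) \<longlongrightarrow> l0 $ j) F" for j
  proof -
    have "((\<lambda>q. (\<Sum>i\<in>UNIV. t q $ i * (l q $ i * l q $ j)) / \<phi> q) \<longlongrightarrow> (\<Sum>i\<in>UNIV. t0 $ i * L i j) / - sqrt m) F"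
      unfolding l_def by (intro tendsto_intros t L lim_\<phi>) (use m in auto)
    moreover have "\<forall>\<^sub>F q in F. (\<Sum>i\<in>UNIV. t q $ i * (l q $ i * l q $ j)) / \<phi> q = l q $ j"
      using ev
    proof eventually_elim
      case (elim q)
      have "(\<Sum>i\<in>UNIV. t q $ i * (l q $ i * l q $ j)) = \<phi> q * l q $ j"
        unfolding \<phi> sum_distrib_right by (simp add: mult_ac)
      moreover have "\<phi> q \<noteq> 0" using elim by (simp add: \<phi>_def)
      ultimately show ?case by simp
    qed
    ultimately show ?thesis unfolding l0_def using tendsto_cong by force
  qed
  note lim_l = this
  \<comment> \<open>Cramer's rule raises the index: it writes the components of \<open>v\<close> as
    quotients of determinants, which visibly converge with \<open>G\<close> and
    \<open>l\<close>.\<close>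
  define v0 where "v0 = (\<chi> k. det (\<chi> i j. if j = k then l0 $ i else G0 $ i $ j) / det G0)"
  have d0: "det G0 \<noteq> 0" using lorentzian_form_det[OF G0(1)] .
  have tdet: "((\<lambda>q. det (B q)) \<longlongrightarrow> det B0) F" if "\<And>i j. ((\<lambda>q. B q $ i $ j) \<longlongrightarrow> B0 $ i $ j) F"
    for B :: "'x \<Rightarrow> real^'d^'d" and B0
    unfolding det_def by (intro tendsto_intros that)
  have Gij: "((\<lambda>q. G q $ i $ j) \<longlongrightarrow> G0 $ i $ j) F" for i j by (intro tendsto_vec_nth G)
  have lim_v: "(v \<longlongrightarrow> v0) F"
  proof (rule vec_tendstoI)
    fix k
    have "((\<lambda>q. det (\<chi> i j. if j = k then l q $ i else G q $ i $ j) / det (G q)) \<longlongrightarrow> v0 $ k) F"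
      unfolding v0_def vec_lambda_beta
      by (intro tendsto_divide tdet d0) (auto intro: Gij lim_l)
    moreover have "\<forall>\<^sub>F q in F. det (\<chi> i j. if j = k then l q $ i else G q $ i $ j) / det (G q) = v q $ k"
      using ev
    proof eventually_elim
      case (elim q)
      then show ?case using lorentzian_form_det[of "G q"] unfolding l_def
        by (simp add: cramer_lemma)
    qed
    ultimately show "((\<lambda>q. v q $ k) \<longlongrightarrow> v0 $ k) F" using tendsto_cong by force
  qed
  have "((\<lambda>q. bilin (G q) (v q) (v q)) \<longlongrightarrow> bilin G0 v0 v0) F" by (intro tendsto_intros G lim_v)
  moreover have "((\<lambda>q. bilin (G q) (v q) (v q)) \<longlongrightarrow> -1) F"
    by (rule tendsto_eventually) (use ev in eventually_elim, simp)
  ultimately have "bilin G0 v0 v0 = -1" using tendsto_unique[OF F] by blast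
  moreover have "(\<phi> \<longlongrightarrow> bilin G0 t0 v0) F" unfolding \<phi>_def by (intro tendsto_intros G lim_v t)
  then have "bilin G0 t0 v0 = - sqrt m" using lim_\<phi> tendsto_unique[OF F] by blast
  ultimately show ?thesis using lim_v m by auto
qed

subsection \<open>Integral curves with nearly constant velocity\<close>

text \<open>A continuity argument running backwards from 0. The velocity is controlled only inside
  the open coordinate ball \<open>N\<close>; while the curve has stayed there, the mean value
  inequality confines it to the strictly smaller closed ball \<open>K\<close>, so there is no
  parameter at which it could first leave.\<close>

lemma curve_stays_in_ball:
  fixes c :: "('a::t2_space, 'd::finite) chart" and \<gamma> :: "real \<Rightarrow> 'a" and o' w :: "real^'d"
  assumes c: "is_chart c" and r: "cball o' r \<subseteq> snd c ` fst c"
    and s2: "s2 \<le> 0" and cont: "continuous_on {s2..0} \<gamma>"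
    and deriv: "\<And>s. s \<in> {s2..0} \<Longrightarrow> \<gamma> s \<in> fst c \<Longrightarrow> snd c (\<gamma> s) \<in> ball o' r \<Longrightarrow>
      \<exists>D. ((snd c \<circ> \<gamma>) has_vector_derivative D) (at s within {s2..0}) \<and> norm (D - w) \<le> \<epsilon>"
    and start: "\<gamma> 0 \<in> fst c" "norm (snd c (\<gamma> 0) - o') + (- s2) * (norm w + \<epsilon>) < r" and "\<epsilon> \<ge> 0"
    and s: "s \<in> {s2..0}"
  shows "\<gamma> s \<in> fst c \<and> snd c (\<gamma> s) \<in> ball o' r \<and> norm (snd c (\<gamma> s) - (snd c (\<gamma> 0) + s *\<^sub>R w)) \<le> \<epsilon> * (- s)"
proof -
  define N where "N = fst c \<inter> snd c -` ball o' r"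
  define \<rho> where "\<rho> = norm (snd c (\<gamma> 0) - o') + (- s2) * (norm w + \<epsilon>)"
  define K where "K = chart_inv c ` cball o' \<rho>"
  have Nopen: "open N" unfolding N_def
    using continuous_on_chart[OF c] c by (auto simp: continuous_on_open_vimage is_chart_def Int_commute)
  have \<rho>: "\<rho> < r" using start by (simp add: \<rho>_def)
  then have sub: "cball o' \<rho> \<subseteq> snd c ` fst c" using r by (meson order_trans less_imp_le subset_cball)
  \<comment> \<open>Compactness makes \<open>K\<close> closed in the whole Hausdorff space, not just
    in the chart domain; a limit of points of \<open>K\<close> therefore cannot escape from the
    chart.\<close>
  have "compact K"
    unfolding K_def using continuous_on_subset[OF continuous_on_chart_inv[OF c] sub]
    by (intro compact_continuous_image compact_cball)
  then have Kcl: "closed K" by (rule compact_imp_closed)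
  have KN: "K \<subseteq> N"
  proof
    fix q assume "q \<in> K"
    then obtain x where x: "x \<in> cball o' \<rho>" "q = chart_inv c x" by (auto simp: K_def)
    then have "snd c q = x" "q \<in> fst c" using chart_inv_right[OF c] chart_inv_in[OF c] sub by blast+
    then show "q \<in> N" using x \<rho> by (auto simp: N_def)
  qed
  have est: "norm (snd c (\<gamma> s) - (snd c (\<gamma> 0) + s *\<^sub>R w)) \<le> \<epsilon> * (- s)"
    if s: "s \<in> {s2..0}" and N: "\<And>t. t \<in> {s..0} \<Longrightarrow> \<gamma> t \<in> N" for s
  proof -
    have "\<exists>D. ((snd c \<circ> \<gamma>) has_vector_derivative D) (at t within {s..0}) \<and> norm (D - w) \<le> \<epsilon>"
      if t: "t \<in> {s..0}" for t
    proof -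
      have "t \<in> {s2..0}" using t s by auto
      then obtain D where "((snd c \<circ> \<gamma>) has_vector_derivative D) (at t within {s2..0})" "norm (D - w) \<le> \<epsilon>"
        using deriv[of t] N[OF t] by (auto simp: N_def)
      moreover have "{s..0} \<subseteq> {s2..0}" using s by auto
      ultimately show ?thesis using has_vector_derivative_within_subset by blast
    qed
    then obtain D where D: "\<And>t. t \<in> {s..0} \<Longrightarrow> ((snd c \<circ> \<gamma>) has_vector_derivative D t) (at t within {s..0})"
      "\<And>t. t \<in> {s..0} \<Longrightarrow> norm (D t - w) \<le> \<epsilon>" by metis
    \<comment> \<open>Subtracting the uniform motion leaves a curve whose derivative
      \<open>D t - w\<close> has norm at most \<epsilon>.\<close>
    define f where "f t = snd c (\<gamma> t) - t *\<^sub>R w" for t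
    have "norm (f s - f 0) \<le> \<epsilon> * norm (s - 0)"
    proof (rule differentiable_bound[of "{s..0}"])
      fix t assume t: "t \<in> {s..0}"
      have "((\<lambda>t. (snd c \<circ> \<gamma>) t - t *\<^sub>R w) has_vector_derivative D t - 1 *\<^sub>R w) (at t within {s..0})"
        using D(1)[OF t]
        by (intro has_vector_derivative_diff) (auto simp: o_def intro!: derivative_eq_intros)
      then show "(f has_derivative (\<lambda>h. h *\<^sub>R (D t - w))) (at t within {s..0})"
        unfolding f_def has_vector_derivative_def by simp
      show "onorm (\<lambda>h. h *\<^sub>R (D t - w)) \<le> \<epsilon>"
        by (rule onorm_le) (use D(2)[OF t] in \<open>simp add: mult.commute[of \<epsilon>] mult_left_mono\<close>)
    qed (use s in auto)
    then show ?thesis using s by (simp add: f_def algebra_simps)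
  qed
  have estK: "\<gamma> s \<in> K" if s: "s \<in> {s2..0}" and N: "\<And>t. t \<in> {s..0} \<Longrightarrow> \<gamma> t \<in> N" for s
  proof -
    have "norm (snd c (\<gamma> s) - o') = norm ((snd c (\<gamma> s) - (snd c (\<gamma> 0) + s *\<^sub>R w)) + (snd c (\<gamma> 0) - o') + s *\<^sub>R w)"
      by simp
    also have "\<dots> \<le> \<epsilon> * (- s) + norm (snd c (\<gamma> 0) - o') + norm (s *\<^sub>R w)"
      using est[OF that] norm_triangle_ineq
      by (meson add_right_mono order_trans)
    also have "\<dots> = norm (snd c (\<gamma> 0) - o') + (- s) * (norm w + \<epsilon>)"
      using s by (simp add: algebra_simps)
    also have "\<dots> \<le> \<rho>" unfolding \<rho>_def
      using s \<open>\<epsilon> \<ge> 0\<close> by (intro add_left_mono mult_right_mono) auto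
    finally have "snd c (\<gamma> s) \<in> cball o' \<rho>" by (simp add: dist_norm norm_minus_commute)
    moreover have "\<gamma> s \<in> fst c" using N[of s] s by (auto simp: N_def)
    ultimately show ?thesis unfolding K_def using chart_inv_left[OF c] by (metis image_eqI)
  qed
  have all: "\<gamma> s \<in> N" if "s \<in> {s2..0}" for s
  proof (rule ccontr)
    assume bad: "\<gamma> s \<notin> N"
    define C where "C = {s2..0} \<inter> \<gamma> -` (- N)"
    have "closed C" unfolding C_def
      by (rule continuous_closed_preimage[OF cont]) (use Nopen in auto)
    then have "compact C" using bounded_subset[of "{s2..0}" C] unfolding compact_eq_bounded_closed
      by (auto simp: C_def)
    moreover have "s \<in> C" using bad that unfolding C_def by simp
    then have "C \<noteq> {}" by blast
    \<comment> \<open>\<open>s1\<close> is the parameter nearest to 0 at which the curve is outside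
      \<open>N\<close>. After it the curve lies in \<open>K\<close>, and closedness of
      \<open>K\<close> puts the value at \<open>s1\<close> into \<open>K\<close> as well.\<close>
    ultimately obtain s1 where s1: "s1 \<in> C" "\<And>t. t \<in> C \<Longrightarrow> t \<le> s1"
      using compact_attains_sup[of C] by blast
    have "(- s2) * (norm w + \<epsilon>) \<ge> 0"
      using s2 \<open>\<epsilon> \<ge> 0\<close> by (intro mult_nonneg_nonneg) auto
    then have "norm (snd c (\<gamma> 0) - o') < r" using start(2) by linarith
    then have "\<gamma> 0 \<in> N" using start(1) by (simp add: N_def dist_norm norm_minus_commute)
    then have s10: "s1 < 0" "s2 \<le> s1" 
      using s1(1) unfolding C_def by (auto simp: less_le)
    have "\<gamma> t \<in> K" if t: "t \<in> {s1<..0}" for t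
    proof (rule estK)
      show "t \<in> {s2..0}" using t s10 by auto
      fix t' assume "t' \<in> {t..0}"
      then have "t' \<in> {s2..0}" "t' \<notin> C" using t s10 s1(2)[of t'] by force+
      then show "\<gamma> t' \<in> N" by (auto simp: C_def)
    qed
    moreover have "(\<gamma> \<longlongrightarrow> \<gamma> s1) (at s1 within {s1<..0})"
      by (rule tendsto_within_subset[of _ _ _ "{s2..0}"])
        (use cont s10 in \<open>auto simp: continuous_on_def\<close>)
    moreover have "at s1 within {s1<..0} \<noteq> bot"
      using s10 by (simp add: at_within_eq_bot_iff)
    ultimately have "\<gamma> s1 \<in> K"
      by (intro Lim_in_closed_set[OF Kcl, of \<gamma> "at s1 within {s1<..0}"])
        (auto simp: eventually_at_filter)
    then show False using KN s1(1) by (auto simp: C_def)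
  qed
  have "norm (snd c (\<gamma> s) - (snd c (\<gamma> 0) + s *\<^sub>R w)) \<le> \<epsilon> * (- s)"
    by (rule est[OF s]) (use s in \<open>auto intro!: all\<close>)
  then show ?thesis using all[OF s] by (auto simp: N_def)
qed

text \<open>Both inequalities are open conditions on point and velocity jointly, so they hold on a
  product neighbourhood; half of \<open>- bilin (G z) w w\<close> serves as the uniform
  bound.\<close>

lemma timelike_cone_neighbourhood:
  fixes c :: "('a::topological_space, 'd::finite) chart"
  assumes c: "is_chart c" "z \<in> fst c" and g: "continuous_on (fst c) G" and T: "continuous_on (fst c) t"
    and w: "bilin (G z) w w < 0" "bilin (G z) (t z) w < 0"
  shows "\<exists>r>0. \<exists>\<kappa>>0. \<exists>\<epsilon>>0. cball (snd c z) r \<subseteq> snd c ` fst c \<and>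
    (\<forall>x\<in>cball (snd c z) r. \<forall>v. norm (v - w) \<le> \<kappa> \<longrightarrow>
      bilin (G (chart_inv c x)) v v < - \<epsilon> \<and> bilin (G (chart_inv c x)) (t (chart_inv c x)) v < (0::real))"
proof -
  let ?S = "snd c ` fst c"
  let ?G = "\<lambda>x. G (chart_inv c x)" and ?t = "\<lambda>x. t (chart_inv c x)"
  define \<epsilon> where "\<epsilon> = - bilin (G z) w w / 2"
  have \<epsilon>: "\<epsilon> > 0" "bilin (G z) w w < - \<epsilon>" using w by (auto simp: \<epsilon>_def)
  have S: "open ?S" using is_chart_opens(2)[OF c(1)] .
  have Gc: "continuous_on ?S ?G" and tc: "continuous_on ?S ?t"
    using continuous_on_compose2[OF g continuous_on_chart_inv[OF c(1)]]
      continuous_on_compose2[OF T continuous_on_chart_inv[OF c(1)]] chart_inv_in[OF c(1)] by blast+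
  have "continuous_on (?S \<times> UNIV) (\<lambda>y. ?G (fst y))" "continuous_on (?S \<times> UNIV) (\<lambda>y. ?t (fst y))"
    by (rule continuous_on_compose2[OF Gc] continuous_on_compose2[OF tc]; auto intro: continuous_intros)+
  then have f: "continuous_on (?S \<times> UNIV) (\<lambda>y. (bilin (?G (fst y)) (snd y) (snd y), bilin (?G (fst y)) (?t (fst y)) (snd y)))"
    by (intro continuous_intros)
  define W where "W = (?S \<times> UNIV) \<inter> (\<lambda>y. (bilin (?G (fst y)) (snd y) (snd y), bilin (?G (fst y)) (?t (fst y)) (snd y))) -` ({..<-\<epsilon>} \<times> {..<0})"
  have "open W" unfolding W_def
    by (rule continuous_open_preimage[OF f]) (auto intro!: open_Times S)
  moreover have "(snd c z, w) \<in> W"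
    using c w(2) \<epsilon> by (auto simp: W_def chart_inv_left)
  ultimately obtain X Y where XY: "open X" "open Y" "(snd c z, w) \<in> X \<times> Y" "X \<times> Y \<subseteq> W"
    by (rule open_prod_elim)
  obtain r where r: "r > 0" "cball (snd c z) r \<subseteq> X" using XY open_contains_cball[of X] by auto
  obtain \<kappa> where \<kappa>: "\<kappa> > 0" "cball w \<kappa> \<subseteq> Y" using XY open_contains_cball[of Y] by auto
  have in_W: "(x, v) \<in> W" if "x \<in> cball (snd c z) r" "norm (v - w) \<le> \<kappa>" for x v
  proof -
    have "v \<in> cball w \<kappa>" using that(2) by (simp add: dist_norm norm_minus_commute)
    then show ?thesis using that(1) r \<kappa> XY(4) by blast
  qed
  have "cball (snd c z) r \<subseteq> ?S"
  proof
    fix x assume "x \<in> cball (snd c z) r"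
    from in_W[OF this, of w] \<kappa> show "x \<in> ?S" by (simp add: W_def)
  qed
  moreover have "bilin (?G x) v v < - \<epsilon> \<and> bilin (?G x) (?t x) v < 0"
    if "x \<in> cball (snd c z) r" "norm (v - w) \<le> \<kappa>" for x v
    using in_W[OF that] by (simp add: W_def)
  ultimately show ?thesis using r(1) \<kappa>(1) \<epsilon>(1) by blast
qed

subsection \<open>A comoving congruence emanating from one point has no limit velocity there\<close>

lemma past_endpoint_interval:
  assumes "is_interval I" "(0::real) \<in> I" "I \<subseteq> {..0}" "has_past_endpoint I \<gamma> z"
  shows "Inf I < 0" "I = {Inf I<..0}"
proof -
  have I: "bdd_below I" "Inf I \<notin> I" using assms(4) by (auto simp: has_past_endpoint_def)
  have le: "Inf I \<le> t" if "t \<in> I" for t using cInf_lower[OF that I(1)] .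
  then show "Inf I < 0" using le[OF assms(2)] I(2) assms(2) by (metis less_le)
  show "I = {Inf I<..0}"
  proof
    show "I \<subseteq> {Inf I<..0}" using le I(2) assms(3) by (force simp: less_le)
    show "{Inf I<..0} \<subseteq> I"
    proof
      fix t assume t: "t \<in> {Inf I<..0}"
      have "I \<noteq> {}" using assms(2) by blast
      then obtain s where "s \<in> I" "s < t"
        using cInf_less_iff[of I t] I(1) t unfolding greaterThanAtMost_iff by blast
      moreover have "t \<le> 0" using t by simp
      ultimately show "t \<in> I" using assms(1,2) unfolding is_interval_1 by (meson less_imp_le)
    qed
  qed
qed

text \<open>The limit enters only through the fact that \<open>u\<close> is within \<epsilon> of
  \<open>w\<close> on a punctured neighbourhood of \<open>z\<close> in \<open>M\<close>. The metric
  \<open>h\<close> certifies the first coordinate segment as a Lipschitz curve.\<close>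

lemma comoving_congruence_no_limit_velocity:
  fixes A :: "('a::{t2_space, second_countable_topology}, 'd::finite) chart set"
    and g :: "('a, 'd) tensor2" and T u :: "('a, 'd) vfield"
  assumes mf: "smooth_manifold UNIV A" and mfM: "smooth_manifold M (restrict_atlas A M)"
    and g: "covariant_tensor2 A g" "continuous_components A g"
    and T: "vector_field A T" "continuous_components A T"
    and u: "vector_field (restrict_atlas A M) u" "smooth_components (restrict_atlas A M) u"
    and M: "M = timelike_future A g T z" "z \<notin> M"
    and h: "complete_riemannian_metric A h"
    and c: "c \<in> A" "z \<in> fst c"
    and endpt: "\<And>I \<gamma>. past_maximal_integral_curve (restrict_atlas A M) u I \<gamma> \<Longrightarrow> has_past_endpoint I \<gamma> z"
    and lim: "((u (chart_restrict c M)) \<longlongrightarrow> w) (at z within M)"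
    and w: "bilin (g c z) w w < 0" "bilin (g c z) (T c z) w < 0"
    and dim: "2 \<le> CARD('d)"
  shows False
proof -
  let ?A = "restrict_atlas A M" and ?c = "chart_restrict c M"
  have ch: "is_chart c" using smooth_manifoldD(1)[OF mf c(1)] .
  have Mopen: "open M" and MU: "(\<Union>c\<in>?A. fst c) = M" using smooth_manifoldD[OF mfM] by blast+
  have cM: "?c \<in> ?A" using chart_restrict_in_atlas[OF mf c(1) Mopen] by (simp add: restrict_atlas_def)
  have gc: "continuous_on (fst c) (g c)" and Tc: "continuous_on (fst c) (T c)"
    using g(2) T(2) c(1) by (simp_all add: continuous_components_def)
  obtain r0 \<kappa> e0 where r0: "r0 > 0" "cball (snd c z) r0 \<subseteq> snd c ` fst c" and \<kappa>: "\<kappa> > 0" and e0: "e0 > 0"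
    and cone': "\<forall>x\<in>cball (snd c z) r0. \<forall>v. norm (v - w) \<le> \<kappa> \<longrightarrow>
      bilin (g c (chart_inv c x)) v v < - e0 \<and> bilin (g c (chart_inv c x)) (T c (chart_inv c x)) v < 0"
    using timelike_cone_neighbourhood[where G = "g c" and t = "T c", OF ch c(2) gc Tc w] by (elim exE conjE)
  note cone = cone'[rule_format]
  \<comment> \<open>The factor 1/4 serves both cases below: the drift
    \<open>3 * \<delta> * \<epsilon>\<close> is less than \<open>\<delta> * \<kappa>\<close>, and
    the chord velocity differs from \<open>w\<close> by at most
    \<open>(\<kappa> + 3 * \<epsilon>) / 2\<close>, which is less than \<kappa>.\<close>
  define \<epsilon> where "\<epsilon> = \<kappa> / 4"
  have \<epsilon>: "\<epsilon> > 0" using \<kappa> by (simp add: \<epsilon>_def)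
  have "\<forall>\<^sub>F q in at z within M. dist (u ?c q) w < \<epsilon>" using lim \<epsilon> by (rule tendstoD)
  then obtain S where S: "open S" "z \<in> S" and S': "\<forall>q\<in>S. q \<noteq> z \<longrightarrow> q \<in> M \<longrightarrow> dist (u ?c q) w < \<epsilon>"
    unfolding eventually_at_topological by blast
  have "open (snd c ` (fst c \<inter> S))" using is_chart_opens(1)[OF ch] S(1) by (intro open_chart_image[OF ch]) auto
  moreover have "snd c z \<in> snd c ` (fst c \<inter> S)" using c S by blast
  ultimately obtain r1 where r1: "r1 > 0" "cball (snd c z) r1 \<subseteq> snd c ` (fst c \<inter> S)"
    using open_contains_cball by blast
  define r where "r = min r0 r1"
  have r: "r > 0" "cball (snd c z) r \<subseteq> cball (snd c z) r0" "cball (snd c z) r \<subseteq> snd c ` (fst c \<inter> S)"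
    using r0 r1 subset_cball[of r r1 "snd c z"] subset_cball[of r r0 "snd c z"] by (auto simp: r_def)
  have r': "cball (snd c z) r \<subseteq> snd c ` fst c" using r r0 by blast
  have u_close: "norm (u ?c q - w) \<le> \<epsilon>" if "q \<in> M" "q \<in> fst c" "snd c q \<in> ball (snd c z) r" for q
  proof -
    have "snd c q \<in> snd c ` (fst c \<inter> S)" using that(3) r(3) ball_subset_cball by blast
    then have "q \<in> S" using chart_inv_left[OF ch] that(2) by (metis IntE imageE)
    then show ?thesis using S' that(1) M(2) by (metis dist_norm less_imp_le)
  qed
  obtain e1 :: "real^'d" where e1: "e1 \<noteq> 0" "orthogonal w e1"
    using orthogonal_to_vector_exists[of w] dim by auto
  \<comment> \<open>The norm \<kappa> is the largest for which the cone condition still covers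
    \<open>w + E\<close>, so that the segment from \<open>z\<close> to \<open>q\<close> is
    timelike.\<close>
  define E where "E = (\<kappa> / norm e1) *\<^sub>R e1"
  have E: "norm E = \<kappa>" "w \<bullet> E = 0" using e1 \<kappa> by (auto simp: E_def orthogonal_def)
  \<comment> \<open>\<open>\<delta> * d\<close> bounds the displacement of \<open>x0\<close> from
    \<open>z\<close> together with a flow of duration \<open>3 * \<delta>\<close> at speed at most
    \<open>norm w + \<epsilon>\<close>; \<delta> makes this half the radius.\<close>
  define d where "d = 4 * norm w + 2 * \<kappa>"
  define \<delta> where "\<delta> = r / (2 * d)"
  have d: "d > 0" using \<kappa> by (simp add: d_def add_nonneg_pos)
  have \<delta>: "\<delta> > 0" "\<delta> * d = r / 2" using r d by (auto simp: \<delta>_def)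
  define x0 where "x0 = snd c z + \<delta> *\<^sub>R (w + E)"
  have nwE: "norm (w + E) \<le> norm w + \<kappa>" using norm_triangle_ineq[of w E] E by simp
  have x0r: "norm (\<delta> *\<^sub>R (w + E)) + 3 * \<delta> * (norm w + \<epsilon>) < r"
  proof -
    have "norm (\<delta> *\<^sub>R (w + E)) + 3 * \<delta> * (norm w + \<epsilon>) \<le> \<delta> * (norm w + \<kappa>) + 3 * \<delta> * (norm w + \<epsilon>)"
      using nwE \<delta>(1) by (simp add: mult_left_mono)
    also have "\<dots> \<le> \<delta> * d" unfolding d_def \<epsilon>_def using \<delta>(1) \<kappa> by (simp add: algebra_simps)
    also have "\<dots> < r" using \<delta> r by simp
    finally show ?thesis .
  qed
  have pos: "0 \<le> 3 * \<delta> * (norm w + \<epsilon>)" using \<delta>(1) \<epsilon> by simp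
  define q where "q = chart_inv c x0"
  have line_in: "snd c z + t *\<^sub>R (w + E) \<in> cball (snd c z) r" if "t \<in> {0..\<delta>}" for t
  proof -
    have "norm (t *\<^sub>R (w + E)) \<le> norm (\<delta> *\<^sub>R (w + E))" using that by (simp add: mult_right_mono)
    then show ?thesis using x0r pos by (simp add: dist_norm)
  qed
  have x0_in: "x0 \<in> cball (snd c z) r" unfolding x0_def using \<delta>(1) by (intro line_in) auto
  have q: "q \<in> fst c" "snd c q = x0"
    using chart_inv_in[OF ch] chart_inv_right[OF ch] x0_in r' unfolding q_def by blast+
  have qM: "q \<in> M"
  proof -
    have "fd_timelike_curve A g T 0 \<delta> (coord_line c (snd c z) (w + E))"
    proof (rule fd_timelike_line[OF mf g(1) T(1) c(1) _ _ _ \<delta>(1) e0 h])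
      fix t assume "t \<in> {0..\<delta>}"
      note t = line_in[OF this]
      have wE: "norm (w + E - w) \<le> \<kappa>" using E by simp
      show "snd c z + t *\<^sub>R (w + E) \<in> snd c ` fst c" using t r' by blast
      show "bilin (g c (coord_line c (snd c z) (w + E) t)) (w + E) (w + E) < - e0"
        "bilin (g c (coord_line c (snd c z) (w + E) t)) (T c (coord_line c (snd c z) (w + E) t)) (w + E) < 0"
        unfolding coord_line_def using cone[OF _ wE] t r(2) by blast+
    qed
    moreover have "coord_line c (snd c z) (w + E) 0 = z" by (simp add: coord_line_def chart_inv_left ch c)
    moreover have "coord_line c (snd c z) (w + E) \<delta> = q" by (simp add: coord_line_def q_def x0_def)
    ultimately show ?thesis unfolding M(1) timelike_future_def by blast
  qed
  obtain I \<gamma> where I: "past_maximal_integral_curve ?A u I \<gamma>" "0 \<in> I" "I \<subseteq> {..0}" "\<gamma> 0 = q"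
    using exists_past_maximal_integral_curve[OF mfM u qM] by blast
  have ic: "integral_curve ?A u I \<gamma>" using I(1) by (simp add: past_maximal_integral_curve_def)
  have iv: "is_interval I" "continuous_on I \<gamma>" and inM: "\<And>t. t \<in> I \<Longrightarrow> \<gamma> t \<in> M"
    using ic MU unfolding integral_curve_def by blast+
  define s0 where "s0 = Inf I"
  have ep: "has_past_endpoint I \<gamma> z" using endpt[OF I(1)] .
  have s0: "s0 < 0" "I = {s0<..0}" using past_endpoint_interval[OF iv(1) I(2,3) ep] by (auto simp: s0_def)
  have limz: "(\<gamma> \<longlongrightarrow> z) (at s0 within I)" using ep by (simp add: has_past_endpoint_def s0_def)
  have est: "\<gamma> s \<in> fst c \<and> snd c (\<gamma> s) \<in> ball (snd c z) r \<and> norm (snd c (\<gamma> s) - (x0 + s *\<^sub>R w)) \<le> \<epsilon> * (- s)"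
    if s: "s \<in> I" "- (3 * \<delta>) \<le> s" for s
  proof -
    have sI: "{s..0} \<subseteq> I" using s s0 by auto
    have "\<gamma> s \<in> fst c \<and> snd c (\<gamma> s) \<in> ball (snd c z) r \<and>
      norm (snd c (\<gamma> s) - (snd c (\<gamma> 0) + s *\<^sub>R w)) \<le> \<epsilon> * (- s)"
    proof (rule curve_stays_in_ball[OF ch r', where ?s2.0 = s and \<epsilon> = \<epsilon> and w = w])
      show "s \<le> 0" using s s0 by auto
      then show "s \<in> {s..0}" by simp
      show "continuous_on {s..0} \<gamma>" using iv(2) sI continuous_on_subset by blast
      show "\<gamma> 0 \<in> fst c" using I(4) q by simp
      have "(- s) * (norm w + \<epsilon>) \<le> 3 * \<delta> * (norm w + \<epsilon>)"
        using s \<epsilon> by (intro mult_right_mono) auto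
      then show "norm (snd c (\<gamma> 0) - snd c z) + (- s) * (norm w + \<epsilon>) < r"
        using x0r unfolding I(4) q(2) x0_def by simp
      show "\<epsilon> \<ge> 0" using \<epsilon> by simp
      fix t assume t: "t \<in> {s..0}" "\<gamma> t \<in> fst c" "snd c (\<gamma> t) \<in> ball (snd c z) r"
      have tM: "\<gamma> t \<in> M" using inM t sI by blast
      have "((snd ?c \<circ> \<gamma>) has_vector_derivative u ?c (\<gamma> t)) (at t within I)"
        using ic cM t tM sI unfolding integral_curve_def by (metis IntI chart_restrict_simps(1) subsetD)
      then have "((snd c \<circ> \<gamma>) has_vector_derivative u ?c (\<gamma> t)) (at t within {s..0})"
        using has_vector_derivative_within_subset[OF _ sI] by simp
      then show "\<exists>D. ((snd c \<circ> \<gamma>) has_vector_derivative D) (at t within {s..0}) \<and> norm (D - w) \<le> \<epsilon>"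
        using u_close[OF tM t(2,3)] by blast
    qed
    then show ?thesis by (simp add: I(4) q(2))
  qed
  show False
  \<comment> \<open>The split is whether the flow line reaches \<open>z\<close> within time
    \<open>3 * \<delta>\<close>. If so, the estimate is passed to the limit at \<open>s0\<close>,
    which is not itself in \<open>I\<close>.\<close>
  proof (cases "- (3 * \<delta>) \<le> s0")
    case True
    have nt: "at s0 within I \<noteq> bot" using s0 by (simp add: at_within_eq_bot_iff)
    have "isCont (snd c) z"
      using continuous_on_chart[OF ch] is_chart_opens(1)[OF ch] c(2) continuous_on_eq_continuous_at by blast
    then have "((\<lambda>s. snd c (\<gamma> s)) \<longlongrightarrow> snd c z) (at s0 within I)" using limz by (rule isCont_tendsto_compose)
    then have 1: "((\<lambda>s. norm (snd c (\<gamma> s) - (x0 + s *\<^sub>R w))) \<longlongrightarrow> norm (snd c z - (x0 + s0 *\<^sub>R w))) (at s0 within I)"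
      by (intro tendsto_intros)
    have 2: "((\<lambda>s. \<epsilon> * (- s)) \<longlongrightarrow> \<epsilon> * (- s0)) (at s0 within I)" by (intro tendsto_intros)
    have "norm (snd c (\<gamma> s) - (x0 + s *\<^sub>R w)) \<le> \<epsilon> * (- s)" if "s \<in> I" for s
      using est[OF that] that True s0 by auto
    then have "\<forall>\<^sub>F s in at s0 within I. norm (snd c (\<gamma> s) - (x0 + s *\<^sub>R w)) \<le> \<epsilon> * (- s)"
      by (simp add: eventually_at_filter)
    from tendsto_le[OF nt 2 1 this]
    have "norm (snd c z - (x0 + s0 *\<^sub>R w)) \<le> \<epsilon> * (- s0)" .
    also have "snd c z - (x0 + s0 *\<^sub>R w) = - ((\<delta> + s0) *\<^sub>R w + \<delta> *\<^sub>R E)"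
      by (simp add: x0_def algebra_simps)
    finally have le: "norm ((\<delta> + s0) *\<^sub>R w + \<delta> *\<^sub>R E) \<le> \<epsilon> * (- s0)"
      by (simp only: norm_minus_cancel)
    \<comment> \<open>Pairing with \<open>E\<close> removes the unknown multiple of \<open>w\<close>
      and leaves a quantity that does not depend on \<open>s0\<close>.\<close>
    have "\<delta> * \<kappa>\<^sup>2 = ((\<delta> + s0) *\<^sub>R w + \<delta> *\<^sub>R E) \<bullet> E"
      using E by (simp add: inner_add_left dot_square_norm)
    also have "\<dots> \<le> norm ((\<delta> + s0) *\<^sub>R w + \<delta> *\<^sub>R E) * \<kappa>" using norm_cauchy_schwarz E by metis
    also have "\<dots> \<le> \<epsilon> * (- s0) * \<kappa>" using le \<kappa> by (intro mult_right_mono) auto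
    also have "\<dots> \<le> \<epsilon> * (3 * \<delta>) * \<kappa>" using True \<epsilon> \<kappa> by (intro mult_right_mono mult_left_mono) auto
    also have "\<dots> = 3 / 4 * (\<delta> * \<kappa>\<^sup>2)" by (simp add: \<epsilon>_def power2_eq_square)
    finally have "\<delta> * \<kappa>\<^sup>2 \<le> 0" by simp
    then show False using \<delta>(1) \<kappa> by (simp add: mult_le_0_iff)
  next
    case False
    define s where "s = - (3 * \<delta>)"
    have sI: "s \<in> I" using False \<delta>(1) s0 by (simp add: s_def)
    define y where "y = snd c (\<gamma> s)"
    have y: "\<gamma> s \<in> fst c" "y \<in> ball (snd c z) r" "norm (y - (x0 + s *\<^sub>R w)) \<le> 3 * \<delta> * \<epsilon>"
      using est[OF sI] by (auto simp: s_def y_def mult.commute)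
    \<comment> \<open>\<open>v\<close> is the velocity of the chord that leads from \<open>y\<close>
      to \<open>z\<close> in time \<open>2 * \<delta>\<close>. As \<open>y\<close> is close to
      \<open>snd c z - (2 * \<delta>) *\<^sub>R w + \<delta> *\<^sub>R E\<close>, it is close to
      \<open>w - (1/2) *\<^sub>R E\<close>.\<close>
    define v where "v = (1 / (2 * \<delta>)) *\<^sub>R (snd c z - y)"
    have "v - w = - (1/2) *\<^sub>R E - (1 / (2 * \<delta>)) *\<^sub>R (y - (x0 + s *\<^sub>R w))"
      using \<delta>(1) unfolding v_def x0_def s_def by (simp add: vec_eq_iff field_simps)
    then have "norm (v - w) \<le> norm ((1/2) *\<^sub>R E) + norm ((1 / (2 * \<delta>)) *\<^sub>R (y - (x0 + s *\<^sub>R w)))"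
      using norm_triangle_ineq4[of "- (1/2) *\<^sub>R E" "(1 / (2 * \<delta>)) *\<^sub>R (y - (x0 + s *\<^sub>R w))"] by simp
    also have "\<dots> = \<kappa> / 2 + (1 / (2 * \<delta>)) * norm (y - (x0 + s *\<^sub>R w))" using E \<delta>(1) by simp
    also have "\<dots> \<le> \<kappa> / 2 + (1 / (2 * \<delta>)) * (3 * \<delta> * \<epsilon>)"
      using y(3) \<delta>(1) by (intro add_left_mono mult_left_mono) auto
    also have "\<dots> \<le> \<kappa>" using \<delta>(1) \<kappa> by (simp add: \<epsilon>_def)
    finally have vw: "norm (v - w) \<le> \<kappa>" .
    obtain \<gamma>1 a b where \<gamma>1: "fd_timelike_curve A g T a b \<gamma>1" "\<gamma>1 a = z" "\<gamma>1 b = \<gamma> s"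
      using inM[OF sI] unfolding M(1) timelike_future_def by force
    \<comment> \<open>A coordinate line has its base point at parameter 0; shifting the base point
      makes the chord start at \<open>y\<close> at the time \<open>b\<close> when the curve from
      \<open>z\<close> arrives there. Together they form a timelike loop at
      \<open>z\<close>.\<close>
    let ?p = "y - b *\<^sub>R v" and ?b = "b + 2 * \<delta>"
    have pin: "?p + t *\<^sub>R v \<in> cball (snd c z) r" if "t \<in> {b..?b}" for t
    proof -
      have "?p + t *\<^sub>R v = (1 - (t - b) / (2 * \<delta>)) *\<^sub>R y + ((t - b) / (2 * \<delta>)) *\<^sub>R snd c z"
        using \<delta>(1) unfolding v_def by (simp add: vec_eq_iff field_simps)
      moreover have "0 \<le> (t - b) / (2 * \<delta>)" "(t - b) / (2 * \<delta>) \<le> 1"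
        using that \<delta>(1) by auto
      ultimately have "?p + t *\<^sub>R v \<in> closed_segment y (snd c z)" unfolding in_segment by blast
      moreover have "closed_segment y (snd c z) \<subseteq> cball (snd c z) r"
        using y(2) r(1) by (intro closed_segment_subset) auto
      ultimately show ?thesis by blast
    qed
    have "fd_timelike_curve A g T a ?b (\<lambda>t. if t \<le> b then \<gamma>1 t else coord_line c ?p v t)"
    proof (rule fd_timelike_concat_line[OF mf g(1) T(1) c(1) _ _ _ _ e0 \<gamma>1(1)])
      show "b < ?b" using \<delta>(1) by simp
      show "\<gamma>1 b = coord_line c ?p v b"
        using \<gamma>1(3) y(1) by (simp add: coord_line_def y_def chart_inv_left[OF ch])
      fix t assume "t \<in> {b..?b}"
      note t = pin[OF this]
      show "?p + t *\<^sub>R v \<in> snd c ` fst c" using t r' by blast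
      show "bilin (g c (coord_line c ?p v t)) v v < - e0"
        "bilin (g c (coord_line c ?p v t)) (T c (coord_line c ?p v t)) v < 0"
        unfolding coord_line_def using cone[OF _ vw] t r(2) by blast+
    qed
    moreover have "a \<le> b" using \<gamma>1(1) by (simp add: fd_timelike_curve_def)
    moreover have "coord_line c ?p v ?b = z"
    proof -
      have "?p + ?b *\<^sub>R v = snd c z" using \<delta>(1) unfolding v_def by (simp add: vec_eq_iff field_simps)
      then show ?thesis by (simp add: coord_line_def chart_inv_left ch c)
    qed
    ultimately have "z \<in> timelike_future A g T z"
      unfolding timelike_future_def using \<delta>(1) \<gamma>1(2)
      by (intro CollectI exI[of _ "\<lambda>t. if t \<le> b then \<gamma>1 t else coord_line c ?p v t"] exI[of _ a] exI[of _ ?b]) auto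
    then show False using M by blast
  qed
qed

subsection \<open>Continuous extensions\<close>

lemma is_continuous_extension_tendsto:
  assumes "is_continuous_extension S z f F"
  shows "(f \<longlongrightarrow> F z) (at z within S)"
proof -
  have "(F \<longlongrightarrow> F z) (at z within insert z S)"
    using assms unfolding is_continuous_extension_def continuous_on_def by blast
  then have "(F \<longlongrightarrow> F z) (at z within S)" by (rule tendsto_within_subset) blast
  moreover have "\<forall>\<^sub>F q in at z within S. F q = f q"
    using assms by (simp add: is_continuous_extension_def eventually_at_filter)
  ultimately show ?thesis using tendsto_cong by force
qed

lemma at_within_boundary_neq_bot:
  assumes "z \<in> closure S - S"
  shows "at z within S \<noteq> bot"
  using assms by (auto simp: closure_def trivial_limit_within)

section \<open>Density and pressure at the boundary point, and the final formula\<close>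

lemma density_plus_pressure_eq_0:
  fixes A :: "('a::{t2_space, second_countable_topology}, 'd::finite) chart set"
    and g :: "('a, 'd) tensor2" and T u :: "('a, 'd) vfield"
  assumes n: "n \<ge> 2" "CARD('d) = n + 1"
    and ext: "continuous_extension A g T M" and z: "z \<in> past_boundary A g T M"
    and M: "M = timelike_future A g T z"
    and fluid: "perfect_fluid (restrict_atlas A M) g T u \<rho> p"
    and ein: "einstein_perfect_fluid (restrict_atlas A M) g u \<rho> p"
    and endpt: "\<And>I \<gamma>. past_maximal_integral_curve (restrict_atlas A M) u I \<gamma> \<Longrightarrow> has_past_endpoint I \<gamma> z"
    and ric: "tensor_extends_continuously A M z (ricci g)"
    and ext_fns: "is_continuous_extension M z \<rho> \<rho>'" "is_continuous_extension M z p p'"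
  shows "\<rho>' z + p' z = 0"
proof (rule ccontr)
  assume ne: "\<rho>' z + p' z \<noteq> 0"
  let ?A = "restrict_atlas A M" and ?F = "at z within M"
  have mf: "smooth_manifold UNIV A" and mfM: "smooth_manifold M ?A"
    and lor: "lorentzian_metric A g" and lorM: "lorentzian_metric ?A g"
    and gcont: "continuous_components A g" and T: "time_orientation A g T"
    using ext unfolding continuous_extension_def continuous_spacetime_def smooth_spacetime_def by blast+
  have cov: "covariant_tensor2 A g" using lor by (simp add: lorentzian_metric_def)
  have TV: "vector_field A T" and Tcont: "continuous_components A T"
    using T by (simp_all add: time_orientation_def)
  have zM: "z \<in> closure M - M" using z by (simp add: past_boundary_def)
  have nb: "?F \<noteq> bot" using at_within_boundary_neq_bot[OF zM] .
  have Mopen: "open M" and MU: "(\<Union>c\<in>?A. fst c) = M" using smooth_manifoldD[OF mfM] by blast+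
  \<comment> \<open>The timelike curve that witnesses membership in the past boundary is Lipschitz
    for some complete metric, which is kept.\<close>
  obtain h where h: "complete_riemannian_metric A h"
    using z unfolding past_boundary_def fd_timelike_curve_def lipschitz_curve_def by blast
  obtain c where c: "c \<in> A" "z \<in> fst c"
    and ext_c: "\<forall>i j. extends_continuously (fst c \<inter> M) z (\<lambda>q. ricci g c q $ i $ j)"
    using ric unfolding tensor_extends_continuously_def by blast
  let ?c = "chart_restrict c M"
  have ch: "is_chart c" using smooth_manifoldD(1)[OF mf c(1)] .
  have copen: "open (fst c)" using is_chart_opens(1)[OF ch] .
  have cM: "?c \<in> ?A" using chart_restrict_in_atlas[OF mf c(1) Mopen] by (simp add: restrict_atlas_def)
  \<comment> \<open>The Ricci components extend only on the part of \<open>M\<close> inside the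
    chart; near \<open>z\<close> this is all of \<open>M\<close>, so the limits can be taken within
    \<open>M\<close>.\<close>
  have Fc: "at z within (fst c \<inter> M) = ?F" by (rule at_within_nhd[OF c(2) copen]) auto
  have ev: "\<forall>\<^sub>F q in at z within M. q \<in> fst c \<and> q \<in> M"
    using copen c(2) unfolding eventually_at_topological by blast
  obtain ric' where ric': "\<And>i j. ((\<lambda>q. ricci g c q $ i $ j) \<longlongrightarrow> ric' i j) ?F"
  proof -
    have "\<exists>l. ((\<lambda>q. ricci g c q $ i $ j) \<longlongrightarrow> l) ?F" for i j
      using ext_c is_continuous_extension_tendsto unfolding extends_continuously_def Fc[symmetric] by blast
    then show ?thesis using that by metis
  qed
  have at_z: "(f \<longlongrightarrow> f z) ?F" if "continuous_on (fst c) f" for f :: "'a \<Rightarrow> 'b::topological_space"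
  proof -
    have "(f \<longlongrightarrow> f z) (at z)"
      using that copen c(2) by (simp add: continuous_on_eq_continuous_at isCont_def)
    then show ?thesis by (rule tendsto_within_subset) simp
  qed
  have limG: "(g c \<longlongrightarrow> g c z) ?F" and limT: "(T c \<longlongrightarrow> T c z) ?F"
    using gcont Tcont c(1) by (auto intro!: at_z simp: continuous_components_def)
  note lim\<rho> = is_continuous_extension_tendsto[OF ext_fns(1)]
    and limp = is_continuous_extension_tendsto[OF ext_fns(2)]
  define R where "R q = 16 * pi / (real n - 1) * (\<rho> q - real n * p q)" for q
  define R0 where "R0 = 16 * pi / (real n - 1) * (\<rho>' z - real n * p' z)"
  have limR: "(R \<longlongrightarrow> R0) ?F" unfolding R_def R0_def by (intro tendsto_intros lim\<rho> limp)
  \<comment> \<open>This is the limit form of the Einstein equations solved for the product of two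
    components of the fluid covector, with the scalar curvature replaced by its expression in
    density and pressure.\<close>
  define L where "L i j = (ric' i j - (1/2 * R0 + 8 * pi * p' z) * g c z $ i $ j) / (8 * pi * (\<rho>' z + p' z))" for i j
  have low: "(g c q *v u ?c q) $ i * (g c q *v u ?c q) $ j =
      (ricci g c q $ i $ j - (1/2 * R q + 8 * pi * p q) * g c q $ i $ j) / (8 * pi * (\<rho> q + p q))"
    if q: "q \<in> fst c" "q \<in> M" and nz: "\<rho> q + p q \<noteq> 0" for q i j
  proof -
    have gq: "g ?c q = g c q" using covariant_tensor2_restrict[OF mf cov c(1) Mopen q] .
    have rq: "ricci g ?c q = ricci g c q" using ricci_restrict[OF mf cov c(1) Mopen q] .
    have "transpose (g c q) = g c q"
      using lor c(1) q(1) by (simp add: lorentzian_metric_def lorentzian_form_def)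
    then have lo: "lower_index g u ?c q = g c q *v u ?c q"
      unfolding lower_index_def gq by (metis transpose_matrix_vector)
    have "scalar_curvature ?A g q = R q"
      unfolding R_def using scalar_curvature_perfect_fluid[OF ein fluid lorM _ n(2,1)] q MU by blast
    then have "ricci g c q $ i $ j - 1/2 * R q * g c q $ i $ j =
        8 * pi * ((\<rho> q + p q) * ((g c q *v u ?c q) $ i * (g c q *v u ?c q) $ j) + p q * g c q $ i $ j)"
      using ein[unfolded einstein_perfect_fluid_def, rule_format, OF cM, of q i j] q
      unfolding gq rq lo by simp
    then have "(g c q *v u ?c q) $ i * (g c q *v u ?c q) $ j * (8 * pi * (\<rho> q + p q)) =
        ricci g c q $ i $ j - (1/2 * R q + 8 * pi * p q) * g c q $ i $ j"
      by (simp add: algebra_simps)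
    moreover have "8 * pi * (\<rho> q + p q) \<noteq> 0" using nz by simp
    ultimately show ?thesis using nonzero_eq_divide_eq by blast
  qed
  have "\<exists>v0. (u ?c \<longlongrightarrow> v0) ?F \<and> bilin (g c z) v0 v0 = -1 \<and> bilin (g c z) (T c z) v0 < 0"
  proof (rule fluid_velocity_tendsto[OF nb limG limT])
    show "lorentzian_form (g c z)" using lor c by (simp add: lorentzian_metric_def)
    show "bilin (g c z) (T c z) (T c z) < 0" using T c by (simp add: time_orientation_def)
    show "\<forall>\<^sub>F q in ?F. lorentzian_form (g c q) \<and> bilin (g c q) (u ?c q) (u ?c q) = -1 \<and>
      bilin (g c q) (T c q) (u ?c q) < 0 \<and> bilin (g c q) (T c q) (T c q) < 0"
      using ev
    proof eventually_elim
      case (elim q)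
      then have q: "q \<in> fst c" "q \<in> M" "q \<in> fst ?c" by auto
      have "future_vec (g ?c q) (T ?c q) (u ?c q) \<and> bilin (g ?c q) (u ?c q) (u ?c q) = -1"
        using fluid cM q(3) unfolding perfect_fluid_def by blast
      then show ?case
        using covariant_tensor2_restrict[OF mf cov c(1) Mopen q(1,2)]
          vector_field_restrict[OF mf TV c(1) Mopen q(1,2)] lor T c(1) q(1)
        by (simp add: future_vec_def lorentzian_metric_def time_orientation_def)
    qed
    fix i j
    have "((\<lambda>q. (ricci g c q $ i $ j - (1/2 * R q + 8 * pi * p q) * g c q $ i $ j) / (8 * pi * (\<rho> q + p q)))
        \<longlongrightarrow> L i j) ?F"
      unfolding L_def by (intro tendsto_intros ric' limR lim\<rho> limp limG) (use ne in auto)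
    moreover have "\<forall>\<^sub>F q in ?F. (ricci g c q $ i $ j - (1/2 * R q + 8 * pi * p q) * g c q $ i $ j) /
        (8 * pi * (\<rho> q + p q)) = (g c q *v u ?c q) $ i * (g c q *v u ?c q) $ j"
    proof -
      have "\<forall>\<^sub>F q in ?F. \<rho> q + p q \<noteq> 0"
        by (rule tendsto_imp_eventually_ne[OF tendsto_add[OF lim\<rho> limp] ne])
      with ev show ?thesis
      proof eventually_elim
        case (elim q)
        then show ?case using low[of q i j] by simp
      qed
    qed
    ultimately show "((\<lambda>q. (g c q *v u ?c q) $ i * (g c q *v u ?c q) $ j) \<longlongrightarrow> L i j) ?F"
      using tendsto_cong by force
  qed
  then obtain w where w: "(u ?c \<longlongrightarrow> w) ?F" "bilin (g c z) w w < 0" "bilin (g c z) (T c z) w < 0" by auto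
  have u: "vector_field ?A u" "smooth_components ?A u" using fluid by (simp_all add: perfect_fluid_def)
  have "2 \<le> CARD('d)" using n by simp
  with comoving_congruence_no_limit_velocity[OF mf mfM cov gcont TV Tcont u M _ h c endpt w]
  show False using zM by blast
qed

theorem corollary2p4:
  fixes n :: nat
    and A :: "('a::{t2_space, second_countable_topology}, 'd::finite) chart set"
    and g :: "('a, 'd) tensor2"
    and T u :: "('a, 'd) vfield"
    and M :: "'a set"
    and \<O> :: 'a
    and \<rho> p :: "'a \<Rightarrow> real"
  assumes "n \<ge> 2" and "CARD('d) = n + 1"
    and "continuous_extension A g T M"
    and "\<O> \<in> past_boundary A g T M"
    and "M = timelike_future A g T \<O>"
    and fluid: "perfect_fluid (restrict_atlas A M) g T u \<rho> p"
    and a: "einstein_perfect_fluid (restrict_atlas A M) g u \<rho> p"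
    and b1: "\<And>I \<gamma>. past_maximal_integral_curve (restrict_atlas A M) u I \<gamma> \<Longrightarrow>
               has_past_endpoint I \<gamma> \<O>"
    and b2: "\<And>b \<gamma>. \<lbrakk>b > 0; integral_curve (restrict_atlas A M) u {0<..b} \<gamma>;
                      has_past_endpoint {0<..b} \<gamma> \<O>; \<gamma> 0 = \<O>\<rbrakk> \<Longrightarrow>
               fd_timelike_curve A g T 0 b \<gamma>"
    and c: "tensor_extends_continuously A M \<O> (ricci g)"
           "extends_continuously M \<O> \<rho>" "extends_continuously M \<O> p"
    and d: "strongly_causal_at A g T \<O> \<or>
            (\<forall>U. open U \<and> \<O> \<in> U \<longrightarrow>
               (\<exists>V. open V \<and> \<O> \<in> V \<and> V \<subseteq> U \<and>
                  past_boundary A g T M \<inter> V \<subseteq> causal_future A g T \<O> V))"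
  shows "extends_continuously M \<O> (scalar_curvature (restrict_atlas A M) g) \<and>
    (\<forall>R' \<rho>'. is_continuous_extension M \<O> (scalar_curvature (restrict_atlas A M) g) R' \<longrightarrow>
       is_continuous_extension M \<O> \<rho> \<rho>' \<longrightarrow>
       R' \<O> = 16 * pi * ((real n + 1) / (real n - 1)) * \<rho>' \<O> \<and>
       (n + 1 = 4 \<longrightarrow> R' \<O> = 32 * pi * \<rho>' \<O>))"
proof -
  let ?R = "scalar_curvature (restrict_atlas A M) g"
  obtain p' where p': "is_continuous_extension M \<O> p p'"
    using c(3) by (auto simp: extends_continuously_def)
  have nb: "at \<O> within M \<noteq> bot"
    using assms(4) at_within_boundary_neq_bot unfolding past_boundary_def by blast
  have "smooth_manifold M (restrict_atlas A M)" "lorentzian_metric (restrict_atlas A M) g"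
    using assms(3) unfolding continuous_extension_def smooth_spacetime_def by blast+
  then have R: "?R q = 16 * pi / (real n - 1) * (\<rho> q - real n * p q)" if "q \<in> M" for q
    using scalar_curvature_perfect_fluid[OF a fluid _ _ assms(2,1)] smooth_manifoldD(3) that by blast
  \<comment> \<open>The trace formula, evaluated on the extended density and pressure, is itself a
    continuous extension of the scalar curvature.\<close>
  define E where "E \<rho>' q = 16 * pi / (real n - 1) * (\<rho>' q - real n * p' q)" for \<rho>' :: "'a \<Rightarrow> real" and q
  have E: "is_continuous_extension M \<O> ?R (E \<rho>')" if "is_continuous_extension M \<O> \<rho> \<rho>'" for \<rho>'
    using that p' R assms(1) unfolding is_continuous_extension_def E_def by (auto intro!: continuous_intros)
  have "R' \<O> = 16 * pi * ((real n + 1) / (real n - 1)) * \<rho>' \<O>"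
    if R': "is_continuous_extension M \<O> ?R R'" and \<rho>': "is_continuous_extension M \<O> \<rho> \<rho>'" for R' \<rho>'
  proof -
    \<comment> \<open>\<O> is a limit point of \<open>M\<close>, so any two continuous extensions
      take the same value there.\<close>
    have "R' \<O> = E \<rho>' \<O>"
      using tendsto_unique[OF nb] is_continuous_extension_tendsto R' E[OF \<rho>'] by blast
    moreover have "p' \<O> = - \<rho>' \<O>"
      using density_plus_pressure_eq_0[OF assms(1-5) fluid a b1 c(1) \<rho>' p'] by simp
    \<comment> \<open>With the pressure equal to minus the density, the bracket in the trace formula
      becomes \<open>(n + 1)\<close> times the density.\<close>
    ultimately show ?thesis by (simp add: E_def field_simps)
  qed
  moreover have "extends_continuously M \<O> ?R"
    using c(2) E unfolding extends_continuously_def by blast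
  moreover have "16 * pi * ((real n + 1) / (real n - 1)) = 32 * pi" if "n + 1 = 4"
  proof -
    have "n = 3" using that by simp
    then show ?thesis by simp
  qed
  ultimately show ?thesis by metis
qed

end
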